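(* Let $y$ be the solution of $-y''+q(x)y=0$ on $\mathbb R$ with $y(0)=0$, $y'(0)=1$, and let $T>0$. Then there is a unique $F\in\mathcal F^T$ with $W^TF=y|_{(-T,T)}$, and this $F$ is the unique solution in $\mathcal F^T$ of the equation $$(C^TF)(t)=(T-t)\begin{pmatrix}1\\0\end{pmatrix},\qquad t\in(0,T).$$
   Context: Let $q\in C^2(\mathbb R)\cap L_1(\mathbb R)$ be real-valued, $\mathcal F^T:=L_2(0,T;\mathbb R^2)$. Wave system: for a control $F=(f_1,f_2)^\top$, $u^F$ solves $u_{tt}-u_{xx}+q(x)u=0$ for $x\ne0$, $t>0$, with $u(\cdot,0)=u_t(\cdot,0)=0$ and $u(0^+,t)-u(0^-,t)=f_1(t)$, $u_x(0^+,t)-u_x(0^-,t)=f_2'(t)$. Kernels: $w_1,w_2$ are the real functions on $\{(x,t):|x|\le t\}$, $C^2$ on each closed wedge $\{0\le x\le t\}$, $\{-t\le x\le0\}$, satisfying $\partial_t^2w_i-\partial_x^2w_i+q(x)w_i=0$ for $0<|x|<t$; $\frac{d}{dx}w_1(x,x)=-\frac{q(x)}4$, $\frac{d}{dx}w_2(x,x)=\frac{q(x)}4$ for $x>0$; $\frac{d}{dx}w_1(x,-x)=\frac{d}{dx}w_2(x,-x)=-\frac{q(x)}4$ for $x<0$; $w_i$, $\partial_xw_i$ continuous across $x=0$; $w_i(0,0)=0$; and such that for every $F\in C_0^\infty((0,\infty);\mathbb R^2)$: $u^F(x,t)=\tfrac12 f_1(t-x)-\tfrac12 f_2(t-x)+\int_x^t(w_1(x,s)f_1(t-s)+w_2(x,s)f_2(t-s))ds$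 for $0<x<t$, $u^F(x,t)=-\tfrac12 f_1(t+x)-\tfrac12 f_2(t+x)+\int_{-x}^t(w_1(x,s)f_1(t-s)+w_2(x,s)f_2(t-s))ds$ for $0<-x<t$, $u^F(x,t)=0$ for $|x|>t$. For $F\in L_2(0,T;\mathbb R^2)$, $u^F(\cdot,T)\in L_2(-T,T)$ is defined by the same formula at $t=T$. Control operator: $W^T:\mathcal F^T\to L_2(-T,T)$, $W^TF=u^F(\cdot,T)$. Connecting operator: $C^T=(W^T)^*W^T$, i.e. $(C^TF,G)_{\mathcal F^T}=(u^F(\cdot,T),u^G(\cdot,T))_{L_2(-T,T)}$. *)

theory Defs
  imports "HOL-Analysis.Analysis"
begin

text \<open>Controls F = (f1,f2) are represented as pairs of real functions; elements of
  L_2(0,T) are represented by (Borel measurable, square integrable) functions,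
  with equality understood almost everywhere.\<close>

definition L2_on :: "real set \<Rightarrow> (real \<Rightarrow> real) \<Rightarrow> bool" where
  "L2_on S f \<longleftrightarrow> f \<in> borel_measurable lborel \<and> set_integrable lborel S (\<lambda>t. (f t)\<^sup>2)"

definition C2_fun :: "(real \<Rightarrow> real) \<Rightarrow> bool" where
  "C2_fun f \<longleftrightarrow> (\<exists>f' f''. (\<forall>x. (f has_real_derivative f' x) (at x)
        \<and> (f' has_real_derivative f'' x) (at x)) \<and> continuous_on UNIV f'')"

definition C2_on :: "(real \<times> real) set \<Rightarrow> (real \<times> real \<Rightarrow> real) \<Rightarrow> bool" where
  "C2_on S f \<longleftrightarrow> (\<exists>(Df :: real \<times> real \<Rightarrow> ((real \<times> real) \<Rightarrow>\<^sub>L real))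
       (D2f :: real \<times> real \<Rightarrow> ((real \<times> real) \<Rightarrow>\<^sub>L ((real \<times> real) \<Rightarrow>\<^sub>L real))).
     (\<forall>z\<in>S. (f has_derivative blinfun_apply (Df z)) (at z within S)
           \<and> (Df has_derivative blinfun_apply (D2f z)) (at z within S))
     \<and> continuous_on S D2f)"

definition smooth_cpt_pos :: "(real \<Rightarrow> real) \<Rightarrow> bool" where
  "smooth_cpt_pos f \<longleftrightarrow> (\<forall>k. \<forall>x. ((deriv ^^ k) f) differentiable (at x))
     \<and> (\<exists>a b. 0 < a \<and> a \<le> b \<and> (\<forall>t. t \<notin> {a..b} \<longrightarrow> f t = 0))"

definition uF :: "(real \<Rightarrow> real \<Rightarrow> real) \<Rightarrow> (real \<Rightarrow> real \<Rightarrow> real)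
     \<Rightarrow> (real \<Rightarrow> real) \<Rightarrow> (real \<Rightarrow> real) \<Rightarrow> real \<Rightarrow> real \<Rightarrow> real" where
  "uF w1 w2 f1 f2 x t =
     (if 0 < x \<and> x < t then
        f1 (t - x) / 2 - f2 (t - x) / 2
        + (LBINT s=x..t. w1 x s * f1 (t - s) + w2 x s * f2 (t - s))
      else if 0 < - x \<and> - x < t then
        - f1 (t + x) / 2 - f2 (t + x) / 2
        + (LBINT s=-x..t. w1 x s * f1 (t - s) + w2 x s * f2 (t - s))
      else 0)"

definition WT :: "(real \<Rightarrow> real \<Rightarrow> real) \<Rightarrow> (real \<Rightarrow> real \<Rightarrow> real) \<Rightarrow> real
     \<Rightarrow> (real \<Rightarrow> real) \<Rightarrow> (real \<Rightarrow> real) \<Rightarrow> real \<Rightarrow> real" where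
  "WT w1 w2 T f1 f2 = (\<lambda>x. uF w1 w2 f1 f2 x T)"

definition in_FT :: "real \<Rightarrow> (real \<Rightarrow> real) \<Rightarrow> (real \<Rightarrow> real) \<Rightarrow> bool" where
  "in_FT T f1 f2 \<longleftrightarrow> L2_on {0<..<T} f1 \<and> L2_on {0<..<T} f2"

text \<open>C^T (f1,f2) = (h1,h2), where C^T = (W^T)^* W^T is characterised by
  (C^T F, G)_{F^T} = (W^T F, W^T G)_{L_2(-T,T)} for all G in F^T.\<close>
definition CT_eq :: "(real \<Rightarrow> real \<Rightarrow> real) \<Rightarrow> (real \<Rightarrow> real \<Rightarrow> real) \<Rightarrow> real
     \<Rightarrow> (real \<Rightarrow> real) \<Rightarrow> (real \<Rightarrow> real) \<Rightarrow> (real \<Rightarrow> real) \<Rightarrow> (real \<Rightarrow> real) \<Rightarrow> bool" where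
  "CT_eq w1 w2 T f1 f2 h1 h2 \<longleftrightarrow> in_FT T h1 h2 \<and>
     (\<forall>g1 g2. in_FT T g1 g2 \<longrightarrow>
        (LBINT t=0..T. h1 t * g1 t + h2 t * g2 t)
        = (LBINT x=-T..T. WT w1 w2 T f1 f2 x * WT w1 w2 T g1 g2 x))"

definition wave_sol :: "(real \<Rightarrow> real) \<Rightarrow> (real \<Rightarrow> real) \<Rightarrow> (real \<Rightarrow> real)
     \<Rightarrow> (real \<Rightarrow> real \<Rightarrow> real) \<Rightarrow> bool" where
  "wave_sol q f1 f2 u \<longleftrightarrow>
     (\<forall>x t. x \<noteq> 0 \<and> 0 < t \<longrightarrow>
        deriv (\<lambda>s. deriv (\<lambda>s'. u x s') s) t - deriv (\<lambda>y. deriv (\<lambda>y'. u y' t) y) x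
        + q x * u x t = 0)
   \<and> (\<forall>x. u x 0 = 0 \<and> deriv (\<lambda>t. u x t) 0 = 0)
   \<and> (\<forall>t>0. \<exists>a b. ((\<lambda>x. u x t) \<longlongrightarrow> a) (at_right 0) \<and> ((\<lambda>x. u x t) \<longlongrightarrow> b) (at_left 0)
              \<and> a - b = f1 t)
   \<and> (\<forall>t>0. \<exists>a b. ((\<lambda>x. deriv (\<lambda>y. u y t) x) \<longlongrightarrow> a) (at_right 0)
              \<and> ((\<lambda>x. deriv (\<lambda>y. u y t) x) \<longlongrightarrow> b) (at_left 0)
              \<and> a - b = deriv f2 t)"

definition kernels :: "(real \<Rightarrow> real) \<Rightarrow> (real \<Rightarrow> real \<Rightarrow> real) \<Rightarrow> (real \<Rightarrow> real \<Rightarrow> real) \<Rightarrow> bool" where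
  "kernels q w1 w2 \<longleftrightarrow>
     (\<forall>w\<in>{w1, w2}.
        C2_on {(x,t). 0 \<le> x \<and> x \<le> t} (case_prod w)
      \<and> C2_on {(x,t). - t \<le> x \<and> x \<le> 0} (case_prod w)
      \<and> (\<forall>x t. 0 < \<bar>x\<bar> \<and> \<bar>x\<bar> < t \<longrightarrow>
           deriv (\<lambda>s. deriv (\<lambda>s'. w x s') s) t - deriv (\<lambda>y. deriv (\<lambda>y'. w y' t) y) x
           + q x * w x t = 0)
      \<and> (\<forall>t>0. (\<lambda>x. w x t) differentiable (at 0))
      \<and> w 0 0 = 0
      \<and> (\<forall>x<0. ((\<lambda>x. w x (- x)) has_real_derivative - q x / 4) (at x)))
   \<and> (\<forall>x>0. ((\<lambda>x. w1 x x) has_real_derivative - q x / 4) (at x))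
   \<and> (\<forall>x>0. ((\<lambda>x. w2 x x) has_real_derivative q x / 4) (at x))
   \<and> (\<forall>f1 f2. smooth_cpt_pos f1 \<and> smooth_cpt_pos f2 \<longrightarrow> wave_sol q f1 f2 (uF w1 w2 f1 f2))"

end

theory Submission
  imports Defs
begin

text \<open>
  In reversed time \<open>\<phi> s = f (T - s)\<close> the values of \<open>W F\<close> at \<open>x\<close> and \<open>- x\<close> form a Volterra system of the
  second kind for \<open>(\<phi>1, \<phi>2)\<close> on \<open>[0, T]\<close>; so \<open>W\<close> is injective (Gronwall) and reaches every continuous
  target (contraction in a weighted supremum norm), in particular \<open>y\<close>.

  By Fubini, pairing \<open>W G\<close> with \<open>y\<close> integrates the control against
  \<open>a y(t) + b y(- t) + \<integral> w(x,t) y(x) dx\<close> over \<open>|x| \<le> t\<close>, where \<open>a\<close>, \<open>b\<close> are the amplitudes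
  \<open>\<plusminus> 1/2\<close> of the two wave fronts.  Differentiating twice in \<open>t\<close>, the Goursat data cancel the front
  terms, and Green's formula with \<open>w_tt = w_xx - q w\<close>, \<open>y'' = q y\<close>, \<open>y(0) = 0\<close> cancels the rest, because the
  contributions \<open>\<plusminus> w(0,t) y'(0)\<close> of the two half-lines are opposite.  Hence this function is linear in \<open>t\<close>:
  it is \<open>t\<close> for \<open>w1\<close> and \<open>0\<close> for \<open>w2\<close>, which is the equation for \<open>C F\<close>.  Testing the difference of two
  solutions of that equation against itself shows that \<open>W\<close> annihilates it.
\<close>

section \<open>Integrals over an expanding wedge\<close>

abbreviation wedge :: "(real \<times> real) set" where
  "wedge \<equiv> {(x, t). 0 \<le> x \<and> x \<le> t}"

text \<open>Evaluating the Frechet derivatives at the basis vectors \<open>(1, 0)\<close> and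
  \<open>(0, 1)\<close> turns the operator-valued data of \<open>C2_on\<close> into scalar
  functions. All derivatives stay relative to \<open>S\<close>, so they are available up to the
  boundary of a wedge.\<close>

lemma C2_on_partials:
  assumes "C2_on S w"
  obtains wx wt wxx wxt wtx wtt where
    "\<And>z. z \<in> S \<Longrightarrow> (w has_derivative (\<lambda>v. fst v * wx z + snd v * wt z)) (at z within S)"
    "\<And>z. z \<in> S \<Longrightarrow> (wx has_derivative (\<lambda>v. fst v * wxx z + snd v * wxt z)) (at z within S)"
    "\<And>z. z \<in> S \<Longrightarrow> (wt has_derivative (\<lambda>v. fst v * wtx z + snd v * wtt z)) (at z within S)"
    "continuous_on S wxx" "continuous_on S wxt" "continuous_on S wtx" "continuous_on S wtt"
proof -
  obtain Df D2f
    where D: "\<And>z. z \<in> S \<Longrightarrow> (w has_derivative blinfun_apply (Df z)) (at z within S)"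
      and D2: "\<And>z. z \<in> S \<Longrightarrow> (Df has_derivative blinfun_apply (D2f z)) (at z within S)"
      and cont: "continuous_on S D2f"
    using assms unfolding C2_on_def by blast
  have split: "blinfun_apply B v = fst v *\<^sub>R blinfun_apply B (1, 0) + snd v *\<^sub>R blinfun_apply B (0, 1)"
    for B :: "(real \<times> real) \<Rightarrow>\<^sub>L 'b::real_normed_vector" and v
  proof -
    have "v = fst v *\<^sub>R (1, 0) + snd v *\<^sub>R (0, 1)"
      by (simp add: prod_eq_iff)
    then show ?thesis
      by (metis blinfun.add_right blinfun.scaleR_right)
  qed
  have part: "((\<lambda>z. blinfun_apply (Df z) e) has_derivative
      (\<lambda>v. fst v * blinfun_apply (blinfun_apply (D2f z) (1, 0)) e
         + snd v * blinfun_apply (blinfun_apply (D2f z) (0, 1)) e)) (at z within S)"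
    if "z \<in> S" for z e
  proof -
    have "((\<lambda>z. blinfun_apply (Df z) e) has_derivative
        (\<lambda>v. blinfun_apply (blinfun_apply (D2f z) v) e)) (at z within S)"
      using bounded_linear.has_derivative[OF blinfun.bounded_linear_left D2[OF that]] by simp
    then show ?thesis
      by (rule has_derivative_eq_rhs) (subst split, simp add: blinfun.bilinear_simps)
  qed
  have cont2: "continuous_on S (\<lambda>z. blinfun_apply (blinfun_apply (D2f z) a) e)" for a e
    by (intro continuous_intros cont)
  have D1: "(w has_derivative (\<lambda>v. fst v * blinfun_apply (Df z) (1, 0) + snd v * blinfun_apply (Df z) (0, 1)))
      (at z within S)" if "z \<in> S" for z
    using D[OF that] by (rule has_derivative_eq_rhs) (rule ext, subst split, simp)
  show ?thesis
    using that[OF D1 part part cont2 cont2 cont2 cont2] by blast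
qed

text \<open>Chain rule relative to \<open>S\<close> and \<open>A\<close>: the curve may run along
  the boundary of a wedge, as the diagonal does, or start on it.\<close>

lemma DERIV_along_curve:
  fixes h hx ht :: "real \<times> real \<Rightarrow> real"
  assumes der: "\<And>z. z \<in> S \<Longrightarrow>
      (h has_derivative (\<lambda>v. fst v * hx z + snd v * ht z)) (at z within S)"
    and a: "(\<alpha> has_real_derivative a) (at s within A)"
    and b: "(\<beta> has_real_derivative b) (at s within A)"
    and sub: "\<And>s. s \<in> A \<Longrightarrow> (\<alpha> s, \<beta> s) \<in> S" and s: "s \<in> A"
  shows "((\<lambda>s. h (\<alpha> s, \<beta> s)) has_real_derivative
      a * hx (\<alpha> s, \<beta> s) + b * ht (\<alpha> s, \<beta> s)) (at s within A)"
proof -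
  have "((\<lambda>s. (\<alpha> s, \<beta> s)) has_derivative (\<lambda>v. (a * v, b * v))) (at s within A)"
    using a b unfolding has_field_derivative_def by (rule has_derivative_Pair)
  from has_derivative_in_compose2[OF der _ s this] sub
  have "((\<lambda>s. h (\<alpha> s, \<beta> s)) has_derivative
      (\<lambda>v. a * v * hx (\<alpha> s, \<beta> s) + b * v * ht (\<alpha> s, \<beta> s))) (at s within A)"
    by auto
  then show ?thesis
    unfolding has_field_derivative_def
    by (rule has_derivative_eq_rhs) (auto simp: algebra_simps)
qed

text \<open>The substitution \<open>x = t * z\<close> moves the variable endpoint into the
  integrand, so that results on parameter integrals over the fixed interval [0, 1] apply. At
  \<open>t = 0\<close> both sides vanish.\<close>

lemma wedge_integral_rescale:
  fixes h :: "real \<Rightarrow> 'b::real_normed_vector"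
  assumes "0 \<le> t"
  shows "integral {0..t} h = integral {0..1} (\<lambda>z. t *\<^sub>R h (t * z))"
proof (cases "t = 0")
  case False
  with assms have "(\<lambda>x. x / t) ` {0..t} = {0..1}"
    by (auto simp: image_iff field_simps intro!: bexI[of _ "_ * t"])
  with integral_stretch_real[OF False, of 0 t h] assms False show ?thesis
    by (simp add: integral_cmul)
qed simp

text \<open>Banach-valued integrands are allowed because the Volterra equation below is solved for
  both control components at once.\<close>

lemma continuous_on_wedge_integral:
  fixes h :: "real \<times> real \<Rightarrow> 'b::banach"
  assumes h: "continuous_on {(x, t). 0 \<le> x \<and> x \<le> t \<and> t \<in> S} h"
    and S: "S \<subseteq> {0..}"
  shows "continuous_on S (\<lambda>t. integral {0..t} (\<lambda>x. h (x, t)))"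
proof -
  have "continuous_on (S \<times> cbox 0 1) (\<lambda>(t, z). t *\<^sub>R h (t * z, t))"
    unfolding case_prod_beta using S
    by (intro continuous_intros continuous_on_compose2[OF h])
      (auto simp: mult_left_le)
  from integral_continuous_on_param[OF this]
  have "continuous_on S (\<lambda>t. integral {0..1} (\<lambda>z. t *\<^sub>R h (t * z, t)))"
    by simp
  moreover have "integral {0..t} (\<lambda>x. h (x, t)) = integral {0..1} (\<lambda>z. t *\<^sub>R h (t * z, t))"
    if "t \<in> S" for t
    using wedge_integral_rescale[of t "\<lambda>x. h (x, t)"] S that by auto
  ultimately show ?thesis
    by (simp cong: continuous_on_cong)
qed

text \<open>After rescaling to [0, 1] the Leibniz rule differentiates \<open>k s z\<close>. The
  result \<open>kd\<close> is split into a total derivative in \<open>z\<close>, which produces the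
  boundary term \<open>h (t, t)\<close>, and the rescaled integral of \<open>ht\<close>. At
  \<open>t = 0\<close> the derivative is one-sided.\<close>

lemma DERIV_wedge_integral:
  fixes h hx ht :: "real \<times> real \<Rightarrow> real"
  assumes der: "\<And>z. z \<in> wedge \<Longrightarrow>
      (h has_derivative (\<lambda>v. fst v * hx z + snd v * ht z)) (at z within wedge)"
    and hx: "continuous_on wedge hx" and ht: "continuous_on wedge ht"
    and t: "0 \<le> t"
  shows "((\<lambda>t. integral {0..t} (\<lambda>x. h (x, t))) has_real_derivative
      h (t, t) + integral {0..t} (\<lambda>x. ht (x, t))) (at t within {0..})"
proof -
  have h: "continuous_on wedge h"
    using der by (rule has_derivative_continuous_on)
  define k where "k s z = s * h (s * z, s)" for s z
  define kd where "kd s z = h (s * z, s) + s * (z * hx (s * z, s) + ht (s * z, s))" for s z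
  have mem: "(s * z, s) \<in> wedge" if "0 \<le> s" "0 \<le> z" "z \<le> 1" for s z :: real
    using that by (auto simp: mult_left_le)
  have kd: "((\<lambda>s. k s z) has_real_derivative kd s z) (at s within {0..})"
    if "s \<in> {0..}" "z \<in> cbox 0 1" for s z
  proof -
    have "((\<lambda>s. h (s * z, s)) has_real_derivative z * hx (s * z, s) + 1 * ht (s * z, s))
        (at s within {0..})"
      by (rule DERIV_along_curve[OF der]) (use mem that in \<open>auto intro!: derivative_eq_intros\<close>)
    then show ?thesis
      unfolding k_def kd_def by (auto intro!: derivative_eq_intros)
  qed
  have cont1: "continuous_on (cbox 0 1) (\<lambda>z. f (s * z, s))"
    if "continuous_on wedge f" "0 \<le> s" for f :: "real \<times> real \<Rightarrow> real" and s
    using that mem by (intro continuous_intros continuous_on_compose2[OF that(1)]) auto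
  have cont: "continuous_on ({0..} \<times> cbox 0 1) (\<lambda>(s, z). kd s z)"
    unfolding case_prod_beta kd_def using mem
    by (intro continuous_intros continuous_on_compose2[OF h] continuous_on_compose2[OF hx]
        continuous_on_compose2[OF ht]) auto
  have leibniz: "((\<lambda>s. integral (cbox 0 1) (k s)) has_real_derivative integral (cbox 0 1) (kd t))
      (at t within {0..})"
  proof (rule leibniz_rule_field_derivative[OF kd _ cont])
    show "k s integrable_on cbox 0 1" if "s \<in> {0..}" for s
      unfolding k_def using that by (intro integrable_continuous continuous_intros cont1[OF h]) auto
  qed (use t in auto)
  have "integral (cbox 0 1) (k s) = integral {0..s} (\<lambda>x. h (x, s))" if "0 \<le> s" for s
    using wedge_integral_rescale[OF that, of "\<lambda>x. h (x, s)"] by (simp add: k_def[abs_def])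
  then have *: "((\<lambda>t. integral {0..t} (\<lambda>x. h (x, t))) has_real_derivative
      integral (cbox 0 1) (kd t)) (at t within {0..})"
    using t by (intro has_field_derivative_transform_within[OF leibniz zero_less_one]) auto
  \<comment> \<open>The part of \<open>kd t z\<close> without \<open>ht\<close> is the
    \<open>z\<close>-derivative of \<open>z * h (t * z, t)\<close>, which runs from 0 to
    \<open>h (t, t)\<close>.\<close>
  have "((\<lambda>z. h (t * z, t) + t * (z * hx (t * z, t))) has_integral 1 * h (t * 1, t) - 0 * h (t * 0, t))
      {0..1}"
  proof (rule fundamental_theorem_of_calculus)
    fix z :: real assume z: "z \<in> {0..1}"
    have "((\<lambda>z. h (t * z, t)) has_real_derivative t * hx (t * z, t) + 0 * ht (t * z, t))
        (at z within {0..1})"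
      by (rule DERIV_along_curve[OF der]) (use mem t z in \<open>auto intro!: derivative_eq_intros\<close>)
    then show "((\<lambda>z. z * h (t * z, t)) has_vector_derivative
        h (t * z, t) + t * (z * hx (t * z, t))) (at z within {0..1})"
      unfolding has_real_derivative_iff_has_vector_derivative[symmetric]
      by (auto intro!: derivative_eq_intros)
  qed simp
  moreover have "((\<lambda>z. t * ht (t * z, t)) has_integral integral {0..t} (\<lambda>x. ht (x, t))) {0..1}"
    unfolding wedge_integral_rescale[OF t] real_scaleR_def
    using cont1[OF ht t]
    by (intro integrable_integral integrable_continuous_real continuous_intros) auto
  ultimately have "(kd t has_integral (1 * h (t * 1, t) - 0 * h (t * 0, t))
      + integral {0..t} (\<lambda>x. ht (x, t))) {0..1}"
    by (rule has_integral_add[THEN has_integral_eq[rotated]]) (simp add: kd_def algebra_simps)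
  with * show ?thesis
    by (simp add: integral_unique)
qed

section \<open>The moment identity\<close>

lemma open_slices:
  assumes "open S"
  shows "open {x. (x, t) \<in> S}" and "open {t. (x, t) \<in> S}"
proof -
  have "continuous_on UNIV (\<lambda>x. (x, t))" "continuous_on UNIV (\<lambda>t. (x, t))"
    by (intro continuous_intros)+
  from this[THEN open_vimage[OF assms]]
  show "open {x. (x, t) \<in> S}" "open {t. (x, t) \<in> S}"
    by (simp_all add: vimage_def)
qed

lemma partial_derivatives_interior:
  fixes h hx ht :: "real \<times> real \<Rightarrow> real"
  assumes h: "\<And>z. z \<in> S \<Longrightarrow> (h has_derivative (\<lambda>v. fst v * hx z + snd v * ht z)) (at z within S)"
    and xt: "(x, t) \<in> interior S"
  shows "((\<lambda>x. h (x, t)) has_real_derivative hx (x, t)) (at x)"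
    and "((\<lambda>t. h (x, t)) has_real_derivative ht (x, t)) (at t)"
proof -
  have der: "(h has_derivative (\<lambda>v. fst v * hx z + snd v * ht z)) (at z within interior S)"
    if "z \<in> interior S" for z
    using has_derivative_subset[OF h interior_subset] that interior_subset by blast
  note op = open_slices(1)[OF open_interior[of S], of t] open_slices(2)[OF open_interior[of S], of x]
  have "((\<lambda>x. h (x, t)) has_real_derivative 1 * hx (x, t) + 0 * ht (x, t)) (at x within {x. (x, t) \<in> interior S})"
    by (rule DERIV_along_curve[OF der]) (use xt in \<open>auto intro!: derivative_eq_intros\<close>)
  then show "((\<lambda>x. h (x, t)) has_real_derivative hx (x, t)) (at x)"
    using at_within_open[OF _ op(1), of x] xt by simp
  have "((\<lambda>t. h (x, t)) has_real_derivative 0 * hx (x, t) + 1 * ht (x, t)) (at t within {t. (x, t) \<in> interior S})"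
    by (rule DERIV_along_curve[OF der]) (use xt in \<open>auto intro!: derivative_eq_intros\<close>)
  then show "((\<lambda>t. h (x, t)) has_real_derivative ht (x, t)) (at t)"
    using at_within_open[OF _ op(2), of t] xt by simp
qed

text \<open>\<open>kernels\<close> states the wave equation with iterated \<open>deriv\<close>. The
  inner \<open>deriv\<close> equals \<open>wx\<close> or \<open>wt\<close> at all points of an open
  slice of the interior, so the outer one may be computed from \<open>wx\<close> or
  \<open>wt\<close> instead.\<close>

lemma second_deriv_interior:
  fixes w wx wt wxx wxt wtx wtt :: "real \<times> real \<Rightarrow> real"
  assumes w: "\<And>z. z \<in> S \<Longrightarrow> (w has_derivative (\<lambda>v. fst v * wx z + snd v * wt z)) (at z within S)"
    and wx: "\<And>z. z \<in> S \<Longrightarrow> (wx has_derivative (\<lambda>v. fst v * wxx z + snd v * wxt z)) (at z within S)"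
    and wt: "\<And>z. z \<in> S \<Longrightarrow> (wt has_derivative (\<lambda>v. fst v * wtx z + snd v * wtt z)) (at z within S)"
    and xt: "(x, t) \<in> interior S"
  shows "deriv (\<lambda>y. deriv (\<lambda>y'. w (y', t)) y) x = wxx (x, t)"
    and "deriv (\<lambda>s. deriv (\<lambda>s'. w (x, s')) s) t = wtt (x, t)"
proof -
  note op = open_slices(1)[OF open_interior[of S], of t] open_slices(2)[OF open_interior[of S], of x]
  have eq: "deriv (\<lambda>y'. w (y', t)) y = wx (y, t)" if "(y, t) \<in> interior S" for y
    using partial_derivatives_interior(1)[OF w that] by (simp add: DERIV_imp_deriv)
  have "((\<lambda>y. deriv (\<lambda>y'. w (y', t)) y) has_real_derivative wxx (x, t)) (at x)"
    by (rule has_field_derivative_transform_within_open[OF partial_derivatives_interior(1)[OF wx xt] op(1)])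
      (use xt eq in auto)
  then show "deriv (\<lambda>y. deriv (\<lambda>y'. w (y', t)) y) x = wxx (x, t)"
    by (rule DERIV_imp_deriv)
  have eq: "deriv (\<lambda>s'. w (x, s')) s = wt (x, s)" if "(x, s) \<in> interior S" for s
    using partial_derivatives_interior(2)[OF w that] by (simp add: DERIV_imp_deriv)
  have "((\<lambda>s. deriv (\<lambda>s'. w (x, s')) s) has_real_derivative wtt (x, t)) (at t)"
    by (rule has_field_derivative_transform_within_open[OF partial_derivatives_interior(2)[OF wt xt] op(2)])
      (use xt eq in auto)
  then show "deriv (\<lambda>s. deriv (\<lambda>s'. w (x, s')) s) t = wtt (x, t)"
    by (rule DERIV_imp_deriv)
qed

lemma interior_wedge:
  fixes x t :: real
  shows "0 < x \<Longrightarrow> x < t \<Longrightarrow> (x, t) \<in> interior wedge"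
    and "- t < x \<Longrightarrow> x < 0 \<Longrightarrow> (x, t) \<in> interior {(x, t). - t \<le> x \<and> x \<le> 0}"
proof -
  have op: "open {z :: real \<times> real. 0 < fst z \<and> fst z < snd z}"
      "open {z :: real \<times> real. - snd z < fst z \<and> fst z < 0}"
    by (intro open_Collect_conj open_Collect_less continuous_intros)+
  show "0 < x \<Longrightarrow> x < t \<Longrightarrow> (x, t) \<in> interior wedge"
    by (rule interiorI[OF op(1)]) auto
  show "- t < x \<Longrightarrow> x < 0 \<Longrightarrow> (x, t) \<in> interior {(x, t). - t \<le> x \<and> x \<le> 0}"
    by (rule interiorI[OF op(2)]) auto
qed

text \<open>One half-line at a time. In the second derivative of the moment, Green's formula leaves
  \<open>wx * y - w * y'\<close> at \<open>x = t\<close>; its \<open>w * y'\<close> cancels against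
  the derivative of the boundary term of \<open>R1\<close>, and \<open>wx + wt\<close> on the
  diagonal equals \<open>c * q\<close>, which doubles the contribution of the diagonal data. At
  \<open>x = 0\<close> the term \<open>w (0, t) * y' 0\<close> survives, to be cancelled by the
  other half-line. Since the data hold for positive arguments, \<open>R1\<close> is differentiated
  at \<open>t > 0\<close> and only continuous at 0.\<close>

lemma goursat_moment_derivatives:
  fixes q y y' :: "real \<Rightarrow> real" and w wx wt wxx wxt wtx wtt :: "real \<times> real \<Rightarrow> real"
  assumes w: "\<And>z. z \<in> wedge \<Longrightarrow> (w has_derivative (\<lambda>v. fst v * wx z + snd v * wt z)) (at z within wedge)"
    and wx: "\<And>z. z \<in> wedge \<Longrightarrow> (wx has_derivative (\<lambda>v. fst v * wxx z + snd v * wxt z)) (at z within wedge)"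
    and wt: "\<And>z. z \<in> wedge \<Longrightarrow> (wt has_derivative (\<lambda>v. fst v * wtx z + snd v * wtt z)) (at z within wedge)"
    and cont: "continuous_on wedge wxx" "continuous_on wedge wxt" "continuous_on wedge wtx" "continuous_on wedge wtt"
    and pde: "\<And>x t. 0 < x \<Longrightarrow> x < t \<Longrightarrow> wtt (x, t) = wxx (x, t) - q x * w (x, t)"
    and diag: "\<And>x. 0 < x \<Longrightarrow> ((\<lambda>x. w (x, x)) has_real_derivative c * q x) (at x)"
    and y: "\<And>x. (y has_real_derivative y' x) (at x)"
    and y': "\<And>x. (y' has_real_derivative q x * y x) (at x)"
    and y0: "y 0 = 0"
  obtains R1 where "continuous_on {0..} R1" "R1 0 = 0"
    "\<And>t. 0 \<le> t \<Longrightarrow> ((\<lambda>t. integral {0..t} (\<lambda>x. w (x, t) * y x)) has_real_derivative R1 t) (at t within {0..})"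
    "\<And>t. 0 < t \<Longrightarrow> (R1 has_real_derivative 2 * c * q t * y t + w (0, t) * y' 0) (at t)"
proof -
  have cont': "continuous_on wedge w" "continuous_on wedge wx" "continuous_on wedge wt"
    by (rule has_derivative_continuous_on, erule w wx wt)+
  have cy: "continuous_on A y" "continuous_on A y'" for A
    using y y' by (auto intro!: continuous_at_imp_continuous_on DERIV_isCont)
  have yz: "((\<lambda>z :: real \<times> real. y (fst z)) has_derivative (\<lambda>v. y' (fst z) * fst v)) (at z within S)" for z S
    by (rule has_derivative_compose[OF has_derivative_fst[OF has_derivative_ident]])
      (use y in \<open>simp add: has_field_derivative_def\<close>)
  define R1 where "R1 t = w (t, t) * y t + integral {0..t} (\<lambda>x. wt (x, t) * y x)" for t
  have R: "((\<lambda>t. integral {0..t} (\<lambda>x. w (x, t) * y x)) has_real_derivative R1 t) (at t within {0..})"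
    if "0 \<le> t" for t
  proof -
    have "((\<lambda>z. w z * y (fst z)) has_derivative
        (\<lambda>v. fst v * (wx z * y (fst z) + w z * y' (fst z)) + snd v * (wt z * y (fst z)))) (at z within wedge)"
      if "z \<in> wedge" for z
      by (rule has_derivative_eq_rhs[OF has_derivative_mult[OF w[OF that] yz]])
        (simp add: fun_eq_iff algebra_simps)
    then have "((\<lambda>t. integral {0..t} (\<lambda>x. w (x, t) * y (fst (x, t)))) has_real_derivative
        w (t, t) * y (fst (t, t)) + integral {0..t} (\<lambda>x. wt (x, t) * y (fst (x, t)))) (at t within {0..})"
      by (rule DERIV_wedge_integral)
        (auto intro!: continuous_intros cont' continuous_on_compose2[OF cy(1)]
          continuous_on_compose2[OF cy(2)] that)
    then show ?thesis
      by (simp add: R1_def)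
  qed
  have M: "((\<lambda>t. integral {0..t} (\<lambda>x. wt (x, t) * y x)) has_real_derivative
      wt (t, t) * y t + integral {0..t} (\<lambda>x. wtt (x, t) * y x)) (at t within {0..})" if "0 \<le> t" for t
  proof -
    have "((\<lambda>z. wt z * y (fst z)) has_derivative
        (\<lambda>v. fst v * (wtx z * y (fst z) + wt z * y' (fst z)) + snd v * (wtt z * y (fst z)))) (at z within wedge)"
      if "z \<in> wedge" for z
      by (rule has_derivative_eq_rhs[OF has_derivative_mult[OF wt[OF that] yz]])
        (simp add: fun_eq_iff algebra_simps)
    then have "((\<lambda>t. integral {0..t} (\<lambda>x. wt (x, t) * y (fst (x, t)))) has_real_derivative
        wt (t, t) * y (fst (t, t)) + integral {0..t} (\<lambda>x. wtt (x, t) * y (fst (x, t)))) (at t within {0..})"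
      by (rule DERIV_wedge_integral)
        (auto intro!: continuous_intros cont cont' continuous_on_compose2[OF cy(1)]
          continuous_on_compose2[OF cy(2)] that)
    then show ?thesis
      by simp
  qed
  \<comment> \<open>The function \<open>wx * y - w * y'\<close> is an antiderivative in
    \<open>x\<close>: the terms \<open>wx * y'\<close> cancel, and
    \<open>wxx * y - w * q * y\<close> is \<open>wtt * y\<close> by the wave equation. That equation
    holds inside the wedge, hence the interior form of the fundamental theorem. The condition
    \<open>y 0 = 0\<close> removes \<open>wx (0, t)\<close>.\<close>
  have green: "integral {0..t} (\<lambda>x. wtt (x, t) * y x)
      = wx (t, t) * y t - w (t, t) * y' t + w (0, t) * y' 0" if t: "0 < t" for t
  proof -
    have slice: "continuous_on {0..t} (\<lambda>x. f (x, t))" if "continuous_on wedge f" for f :: "real \<times> real \<Rightarrow> real"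
      by (intro continuous_on_compose2[OF that] continuous_intros) auto
    have "((\<lambda>x. wtt (x, t) * y x) has_integral
        (wx (t, t) * y t - w (t, t) * y' t) - (wx (0, t) * y 0 - w (0, t) * y' 0)) {0..t}"
    proof (rule fundamental_theorem_of_calculus_interior)
      show "continuous_on {0..t} (\<lambda>x. wx (x, t) * y x - w (x, t) * y' x)"
        by (intro continuous_intros cy slice cont')
      fix x assume x: "x \<in> {0<..<t}"
      then have "((\<lambda>x. wx (x, t)) has_real_derivative wxx (x, t)) (at x)"
        "((\<lambda>x. w (x, t)) has_real_derivative wx (x, t)) (at x)"
        using partial_derivatives_interior(1)[OF wx interior_wedge(1)]
          partial_derivatives_interior(1)[OF w interior_wedge(1)] by auto
      then have "((\<lambda>x. wx (x, t) * y x - w (x, t) * y' x) has_real_derivative wtt (x, t) * y x) (at x)"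
        using x by (auto intro!: derivative_eq_intros y y' simp: pde algebra_simps)
      then show "((\<lambda>x. wx (x, t) * y x - w (x, t) * y' x) has_vector_derivative wtt (x, t) * y x) (at x)"
        by (simp add: has_real_derivative_iff_has_vector_derivative)
    qed (use t in simp)
    then show ?thesis
      by (simp add: integral_unique y0)
  qed
  have R1: "(R1 has_real_derivative 2 * c * q t * y t + w (0, t) * y' 0) (at t)" if t: "0 < t" for t
  proof -
    \<comment> \<open>The chain rule along the diagonal is compared with the Goursat datum
      \<open>diag\<close>; uniqueness of derivatives gives \<open>slope\<close>.\<close>
    have "((\<lambda>s. w (s, s)) has_real_derivative 1 * wx (t, t) + 1 * wt (t, t)) (at t within {0<..})"
      by (rule DERIV_along_curve[OF w]) (use t in \<open>auto intro!: derivative_eq_intros\<close>)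
    then have "((\<lambda>s. w (s, s)) has_real_derivative wx (t, t) + wt (t, t)) (at t)"
      using t at_within_open[of t "{0<..}"] by simp
    from DERIV_unique[OF this diag[OF t]] have slope: "wx (t, t) + wt (t, t) = c * q t" .
    have "at t within {0..} = at t"
      using t by (intro at_within_interior) auto
    then have "((\<lambda>t. integral {0..t} (\<lambda>x. wt (x, t) * y x)) has_real_derivative
        wt (t, t) * y t + integral {0..t} (\<lambda>x. wtt (x, t) * y x)) (at t)"
      using M[of t] t by simp
    from DERIV_add[OF DERIV_mult[OF diag[OF t] y] this]
    have "(R1 has_real_derivative c * q t * y t + y' t * w (t, t)
        + (wt (t, t) * y t + integral {0..t} (\<lambda>x. wtt (x, t) * y x))) (at t)"
      by (simp add: R1_def[abs_def])
    moreover have "c * q t * y t + y' t * w (t, t)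
        + (wt (t, t) * y t + (wx (t, t) * y t - w (t, t) * y' t + w (0, t) * y' 0))
        = c * q t * y t + (wx (t, t) + wt (t, t)) * y t + w (0, t) * y' 0"
      by (simp add: algebra_simps)
    moreover have "c * q t * y t + c * q t * y t = 2 * c * q t * y t"
      by simp
    ultimately show ?thesis
      unfolding green[OF t] slope by simp
  qed
  have "continuous_on {0..} R1"
  proof -
    have "continuous_on {0..} (\<lambda>t. w (t, t))"
      by (intro continuous_on_compose2[OF cont'(1)] continuous_intros) auto
    moreover have "continuous_on {0..} (\<lambda>t. integral {0..t} (\<lambda>x. wt (x, t) * y x))"
      by (rule DERIV_continuous_on[OF M]) simp
    ultimately show ?thesis
      unfolding R1_def by (auto intro!: continuous_intros cy)
  qed
  from that[OF this _ R R1] show ?thesis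
    by (simp add: R1_def y0)
qed

text \<open>The map \<open>x \<mapsto> - x\<close> carries the right wedge onto the left one and
  reverses the sign of the \<open>x\<close>-derivative alone. It reduces the left half-line to the
  right one, with potential \<open>q (- x)\<close> and solution \<open>y (- x)\<close>.\<close>

lemma reflect_partials:
  fixes f fx ft :: "real \<times> real \<Rightarrow> real"
  assumes "\<And>z. z \<in> {(x, t). - t \<le> x \<and> x \<le> 0} \<Longrightarrow>
      (f has_derivative (\<lambda>v. fst v * fx z + snd v * ft z)) (at z within {(x, t). - t \<le> x \<and> x \<le> 0})"
    and "z \<in> wedge"
  shows "((\<lambda>z. f (- fst z, snd z)) has_derivative
      (\<lambda>v. fst v * (- fx (- fst z, snd z)) + snd v * ft (- fst z, snd z))) (at z within wedge)"
proof -
  have "((\<lambda>z :: real \<times> real. (- fst z, snd z)) has_derivative (\<lambda>v. (- fst v, snd v))) (at z within wedge)"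
    by (auto intro!: derivative_eq_intros)
  from has_derivative_in_compose2[OF assms(1) _ assms(2) this] show ?thesis
    by (rule has_derivative_eq_rhs) auto
qed

text \<open>The diagonal slopes \<open>- a / 2 * q\<close> and \<open>b / 2 * q\<close> are matched
  to the front amplitudes: twice differentiated, \<open>a * y t\<close> and
  \<open>b * y (- t)\<close> give \<open>a * q t * y t\<close> and
  \<open>b * q (- t) * y (- t)\<close>, exactly what the two wedge moments subtract. The reflected
  solution has slope \<open>- y' 0\<close> at 0, so the two terms with \<open>w 0 t\<close> are
  opposite. The second derivative vanishes, and the value and slope at 0 fix the line.\<close>

lemma goursat_moment:
  fixes q y y' :: "real \<Rightarrow> real" and w :: "real \<Rightarrow> real \<Rightarrow> real" and a b :: real
  assumes C2r: "C2_on wedge (case_prod w)"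
    and C2l: "C2_on {(x, t). - t \<le> x \<and> x \<le> 0} (case_prod w)"
    and pde: "\<And>x t. 0 < \<bar>x\<bar> \<Longrightarrow> \<bar>x\<bar> < t \<Longrightarrow>
      deriv (\<lambda>s. deriv (\<lambda>s'. w x s') s) t - deriv (\<lambda>y. deriv (\<lambda>y'. w y' t) y) x + q x * w x t = 0"
    and diagr: "\<And>x. 0 < x \<Longrightarrow> ((\<lambda>x. w x x) has_real_derivative - a / 2 * q x) (at x)"
    and diagl: "\<And>x. x < 0 \<Longrightarrow> ((\<lambda>x. w x (- x)) has_real_derivative b / 2 * q x) (at x)"
    and y: "\<And>x. (y has_real_derivative y' x) (at x)"
    and y': "\<And>x. (y' has_real_derivative q x * y x) (at x)"
    and y0: "y 0 = 0" and t: "0 \<le> t"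
  shows "a * y t + b * y (- t) + integral {0..t} (\<lambda>x. w x t * y x)
    + integral {0..t} (\<lambda>x. w (- x) t * y (- x)) = (a - b) * y' 0 * t"
proof -
  let ?L = "{(x, t). - t \<le> x \<and> x \<le> (0 :: real)}"
  obtain R where R: "continuous_on {0..} R" "R 0 = 0"
    "\<And>t. 0 \<le> t \<Longrightarrow> ((\<lambda>t. integral {0..t} (\<lambda>x. w x t * y x)) has_real_derivative R t) (at t within {0..})"
    "\<And>t. 0 < t \<Longrightarrow> (R has_real_derivative - a * q t * y t + w 0 t * y' 0) (at t)"
  proof -
    obtain wx wt wxx wxt wtx wtt where
      w: "\<And>z. z \<in> wedge \<Longrightarrow> (case_prod w has_derivative (\<lambda>v. fst v * wx z + snd v * wt z)) (at z within wedge)" and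
      wx: "\<And>z. z \<in> wedge \<Longrightarrow> (wx has_derivative (\<lambda>v. fst v * wxx z + snd v * wxt z)) (at z within wedge)" and
      wt: "\<And>z. z \<in> wedge \<Longrightarrow> (wt has_derivative (\<lambda>v. fst v * wtx z + snd v * wtt z)) (at z within wedge)" and
      cont: "continuous_on wedge wxx" "continuous_on wedge wxt" "continuous_on wedge wtx" "continuous_on wedge wtt"
      using C2_on_partials[OF C2r] by blast
    have eq: "wtt (x, t) = wxx (x, t) - q x * case_prod w (x, t)" if "0 < x" "x < t" for x t
      using second_deriv_interior[OF w wx wt interior_wedge(1)[OF that]] pde[of x t] that by simp
    show thesis
      by (rule goursat_moment_derivatives[OF w wx wt cont eq _ y y' y0, of "- a / 2"])
        (use diagr that in auto)
  qed
  obtain L where L: "continuous_on {0..} L" "L 0 = 0"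
    "\<And>t. 0 \<le> t \<Longrightarrow> ((\<lambda>t. integral {0..t} (\<lambda>x. w (- x) t * y (- x))) has_real_derivative L t) (at t within {0..})"
    "\<And>t. 0 < t \<Longrightarrow> (L has_real_derivative - b * q (- t) * y (- t) - w 0 t * y' 0) (at t)"
  proof -
    obtain wx wt wxx wxt wtx wtt where
      w: "\<And>z. z \<in> ?L \<Longrightarrow> (case_prod w has_derivative (\<lambda>v. fst v * wx z + snd v * wt z)) (at z within ?L)" and
      wx: "\<And>z. z \<in> ?L \<Longrightarrow> (wx has_derivative (\<lambda>v. fst v * wxx z + snd v * wxt z)) (at z within ?L)" and
      wt: "\<And>z. z \<in> ?L \<Longrightarrow> (wt has_derivative (\<lambda>v. fst v * wtx z + snd v * wtt z)) (at z within ?L)" and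
      cont: "continuous_on ?L wxx" "continuous_on ?L wxt" "continuous_on ?L wtx" "continuous_on ?L wtt"
      using C2_on_partials[OF C2l] by blast
    let ?\<rho> = "\<lambda>z :: real \<times> real. (- fst z, snd z)"
    \<comment> \<open>The first \<open>x\<close>-partial of the reflected kernel is
      \<open>- wx\<close>; differentiating once more in \<open>x\<close> restores the sign of
      \<open>wxx\<close>, while the mixed partial keeps its minus.\<close>
    have mwx: "((\<lambda>z. - wx (?\<rho> z)) has_derivative
        (\<lambda>v. fst v * wxx (?\<rho> z) + snd v * (- wxt (?\<rho> z)))) (at z within wedge)" if "z \<in> wedge" for z
      by (rule has_derivative_eq_rhs[OF has_derivative_minus[OF reflect_partials[OF wx that]]]) auto
    have cont\<rho>: "continuous_on wedge (\<lambda>z. f (?\<rho> z))" if "continuous_on ?L f" for f :: "real \<times> real \<Rightarrow> real"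
      by (intro continuous_on_compose2[OF that] continuous_intros) auto
    have pde\<rho>: "wtt (?\<rho> (x, t)) = wxx (?\<rho> (x, t)) - q (- x) * case_prod w (?\<rho> (x, t))"
      if "0 < x" "x < t" for x t
      using second_deriv_interior[OF w wx wt interior_wedge(2)[of t "- x"]] pde[of "- x" t] that by simp
    have diag\<rho>: "((\<lambda>x. case_prod w (?\<rho> (x, x))) has_real_derivative - b / 2 * q (- x)) (at x)" if "0 < x" for x
      using DERIV_chain2[OF diagl[of "- x"] DERIV_minus[OF DERIV_ident]] that by simp
    have y\<rho>: "((\<lambda>x. y (- x)) has_real_derivative - y' (- x)) (at x)" for x
      using DERIV_chain2[OF y[of "- x"] DERIV_minus[OF DERIV_ident]] by simp
    have y'\<rho>: "((\<lambda>x. - y' (- x)) has_real_derivative q (- x) * y (- x)) (at x)" for x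
      using DERIV_minus[OF DERIV_chain2[OF y'[of "- x"] DERIV_minus[OF DERIV_ident]]] by simp
    show thesis
      by (rule goursat_moment_derivatives[OF reflect_partials[OF w] mwx reflect_partials[OF wt]
            cont\<rho>[OF cont(1)] _ _ cont\<rho>[OF cont(4)] pde\<rho> diag\<rho> y\<rho> y'\<rho>])
        (use y0 that cont\<rho>[OF cont(2)] cont\<rho>[OF cont(3)] in \<open>auto intro!: continuous_intros\<close>)
  qed
  define P where "P t = a * y t + b * y (- t) + integral {0..t} (\<lambda>x. w x t * y x)
    + integral {0..t} (\<lambda>x. w (- x) t * y (- x))" for t
  define P1 where "P1 t = a * y' t - b * y' (- t) + R t + L t" for t
  have ym: "((\<lambda>x. y (- x)) has_real_derivative - y' (- x)) (at x)"
      "((\<lambda>x. y' (- x)) has_real_derivative - q (- x) * y (- x)) (at x)" for x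
    using DERIV_chain2[OF y[of "- x"] DERIV_minus[OF DERIV_ident]]
      DERIV_chain2[OF y'[of "- x"] DERIV_minus[OF DERIV_ident]] by simp_all
  have P1': "(P1 has_real_derivative 0) (at t)" if "0 < t" for t
    unfolding P1_def
    by (rule derivative_eq_intros y' ym R(4)[OF that] L(4)[OF that] refl)+ (simp add: algebra_simps)
  have cont: "continuous_on {0..} P1"
    unfolding P1_def
    by (intro continuous_intros R L continuous_at_imp_continuous_on ballI
        DERIV_isCont[OF y'] DERIV_isCont[OF ym(2)])
  \<comment> \<open>The derivative of \<open>P1\<close> vanishes for positive arguments, and
    continuity at 0 propagates the value there, where \<open>R\<close> and \<open>L\<close> are
    0.\<close>
  have P1: "P1 t = (a - b) * y' 0" if "0 \<le> t" for t
  proof (cases "t = 0")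
    case False
    have "P1 t = P1 0"
      by (rule DERIV_isconst_end)
        (use False that P1' continuous_on_subset[OF cont] in auto)
    then show ?thesis
      by (simp add: P1_def R L algebra_simps)
  qed (simp add: P1_def R L algebra_simps)
  have P: "(P has_real_derivative (a - b) * y' 0) (at t within {0..})" if "0 \<le> t" for t
  proof -
    have "(P has_real_derivative P1 t) (at t within {0..})"
      unfolding P_def P1_def
      by (rule derivative_eq_intros has_field_derivative_at_within[OF y]
          has_field_derivative_at_within[OF ym(1)] R(3)[OF that] L(3)[OF that] refl)+ simp
    then show ?thesis
      using P1[OF that] by simp
  qed
  \<comment> \<open>Subtracting the candidate line leaves a constant, which is 0 at
    \<open>t = 0\<close> because \<open>y 0 = 0\<close>.\<close>
  have "((\<lambda>t. P t - (a - b) * y' 0 * t) has_real_derivative 0) (at t within {0..})" if "t \<in> {0..}" for t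
    by (rule derivative_eq_intros P refl)+ (use that in auto)
  then have "\<exists>c. \<forall>t\<in>{0..}. P t - (a - b) * y' 0 * t = c"
    by (intro has_field_derivative_zero_constant) auto
  then obtain c where "P t - (a - b) * y' 0 * t = c" if "0 \<le> t" for t
    by auto
  from this[of 0] this[of t] t show ?thesis
    by (simp add: P_def y0)
qed

section \<open>The Volterra operator on integrable functions\<close>

definition triangle :: "real \<Rightarrow> (real \<times> real) set" where
  "triangle T = {(x, s). 0 \<le> x \<and> x \<le> s \<and> s \<le> T}"

lemma compact_triangle: "compact (triangle T)"
proof (rule compact_Int_closed[of "{0..T} \<times> {0..T}" "{z. fst z \<le> snd z}", THEN back_subst[of compact]])
  show "closed {z :: real \<times> real. fst z \<le> snd z}"
    by (intro closed_Collect_le continuous_intros)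
qed (auto simp: triangle_def intro!: compact_Times)

lemma triangle_bound:
  fixes w :: "real \<Rightarrow> real \<Rightarrow> real"
  assumes "continuous_on (triangle T) (case_prod w)"
  obtains M where "0 < M" "\<And>x s. 0 \<le> x \<Longrightarrow> x \<le> s \<Longrightarrow> s \<le> T \<Longrightarrow> \<bar>w x s\<bar> \<le> M"
proof -
  have "bounded (case_prod w ` triangle T)"
    by (intro compact_imp_bounded compact_continuous_image assms compact_triangle)
  then obtain M where "0 < M" "\<forall>z\<in>triangle T. \<bar>case_prod w z\<bar> \<le> M"
    unfolding bounded_pos by auto
  with that[of M] show ?thesis
    by (auto simp: triangle_def)
qed

text \<open>The Volterra operator written with the indicator of the triangle, so that it is
  manifestly a Borel function of \<open>x\<close>.\<close>

definition volterra :: "real \<Rightarrow> (real \<Rightarrow> real \<Rightarrow> real) \<Rightarrow> (real \<Rightarrow> real) \<Rightarrow> real \<Rightarrow> real" where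
  "volterra T w \<phi> x = (LBINT s. indicator (triangle T) (x, s) * w x s * \<phi> s)"

context
  fixes T :: real and w :: "real \<Rightarrow> real \<Rightarrow> real" and \<phi> :: "real \<Rightarrow> real"
  assumes w: "continuous_on (triangle T) (case_prod w)"
    and \<phi>: "set_integrable lborel {0..T} \<phi>" and \<phi>m: "\<phi> \<in> borel_measurable borel"
begin

lemma triangle_kernel_measurable:
  "(\<lambda>(x, s). indicator (triangle T) (x, s) * w x s) \<in> borel_measurable (lborel \<Otimes>\<^sub>M lborel)"
proof -
  have "(\<lambda>z. indicator (triangle T) z *\<^sub>R case_prod w z) \<in> borel_measurable borel"
    by (intro borel_measurable_continuous_on_indicator w borel_compact compact_triangle)
  then show ?thesis
    by (simp add: lborel_prod case_prod_beta')
qed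

lemma volterra_integrand_measurable:
  "(\<lambda>(x, s). indicator (triangle T) (x, s) * w x s * \<phi> s) \<in> borel_measurable (lborel \<Otimes>\<^sub>M lborel)"
proof -
  have "(\<lambda>z. (case z of (x, s) \<Rightarrow> indicator (triangle T) (x, s) * w x s) * \<phi> (snd z))
      \<in> borel_measurable (lborel \<Otimes>\<^sub>M lborel)"
    using triangle_kernel_measurable \<phi>m by measurable
  then show ?thesis
    by (simp add: case_prod_beta')
qed

lemma volterra_measurable: "volterra T w \<phi> \<in> borel_measurable borel"
  using lborel.borel_measurable_lebesgue_integral[OF volterra_integrand_measurable]
  by (simp add: volterra_def[abs_def])

text \<open>Keeping the indicator of \<open>{x..T}\<close> in the majorant preserves the tail
  integral needed for Gronwall; the indicator of \<open>{0..T}\<close> at \<open>x\<close> covers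
  points where the triangle has an empty slice.\<close>

lemma volterra_integrand_bound:
  assumes "\<And>x s. 0 \<le> x \<Longrightarrow> x \<le> s \<Longrightarrow> s \<le> T \<Longrightarrow> \<bar>w x s\<bar> \<le> M"
  shows "\<bar>indicator (triangle T) (x, s) * w x s * \<phi> s\<bar>
    \<le> M * (indicator {0..T} x * (indicator {x..T} s * \<bar>\<phi> s\<bar>))"
  using assms by (auto simp: indicator_def triangle_def abs_mult intro: mult_right_mono)

lemma integrable_abs_\<phi>: "0 \<le> x \<Longrightarrow> integrable lborel (\<lambda>s. indicator {x..T} s * \<bar>\<phi> s\<bar>)"
  using set_integrable_subset[OF set_integrable_abs[OF \<phi>], of "{x..T}"]
  by (simp add: set_integrable_def)

lemma volterra_integrand_integrable:
  "integrable lborel (\<lambda>s. indicator (triangle T) (x, s) * w x s * \<phi> s)"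
proof -
  obtain M where M: "0 < M" "\<And>x s. 0 \<le> x \<Longrightarrow> x \<le> s \<Longrightarrow> s \<le> T \<Longrightarrow> \<bar>w x s\<bar> \<le> M"
    using triangle_bound[OF w] by blast
  show ?thesis
  proof (rule Bochner_Integration.integrable_bound)
    show "integrable lborel (\<lambda>s. M * (indicator {0..T} x * (indicator {x..T} s * \<bar>\<phi> s\<bar>)))"
      using integrable_abs_\<phi>[of x] by (auto simp: indicator_def)
    show "(\<lambda>s. indicator (triangle T) (x, s) * w x s * \<phi> s) \<in> borel_measurable lborel"
      using measurable_Pair2[OF volterra_integrand_measurable, of x] by simp
    show "AE s in lborel. norm (indicator (triangle T) (x, s) * w x s * \<phi> s)
        \<le> norm (M * (indicator {0..T} x * (indicator {x..T} s * \<bar>\<phi> s\<bar>)))"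
      using volterra_integrand_bound[OF M(2)] M(1) by (simp add: abs_mult)
  qed
qed

text \<open>Links the indicator form to the integral from \<open>x\<close> to \<open>T\<close> in
  \<open>uF\<close>; the integrability clause allows the sum of the two kernel terms there to be
  split.\<close>

lemma volterra_eq:
  assumes "0 \<le> x" "x \<le> T"
  shows "volterra T w \<phi> x = (LBINT s:{x..T}. w x s * \<phi> s)"
    and "set_integrable lborel {x..T} (\<lambda>s. w x s * \<phi> s)"
proof -
  have eq: "indicator (triangle T) (x, s) * w x s * \<phi> s = indicator {x..T} s *\<^sub>R (w x s * \<phi> s)" for s
    using assms by (auto simp: triangle_def indicator_def)
  show "volterra T w \<phi> x = (LBINT s:{x..T}. w x s * \<phi> s)"
    unfolding volterra_def set_lebesgue_integral_def by (simp only: eq)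
  show "set_integrable lborel {x..T} (\<lambda>s. w x s * \<phi> s)"
    using volterra_integrand_integrable[of x] unfolding set_integrable_def by (simp only: eq)
qed

lemma abs_volterra_le:
  assumes "\<And>x s. 0 \<le> x \<Longrightarrow> x \<le> s \<Longrightarrow> s \<le> T \<Longrightarrow> \<bar>w x s\<bar> \<le> M" and x: "0 \<le> x" "x \<le> T"
  shows "\<bar>volterra T w \<phi> x\<bar> \<le> M * (LBINT s:{x..T}. \<bar>\<phi> s\<bar>)"
proof -
  have "\<bar>volterra T w \<phi> x\<bar> \<le> (LBINT s. \<bar>indicator (triangle T) (x, s) * w x s * \<phi> s\<bar>)"
    unfolding volterra_def by (rule integral_abs_bound)
  also have "\<dots> \<le> (LBINT s. M * (indicator {0..T} x * (indicator {x..T} s * \<bar>\<phi> s\<bar>)))"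
    using volterra_integrand_bound[OF assms(1)]
    by (intro integral_mono integrable_abs volterra_integrand_integrable integrable_mult_right
        integrable_abs_\<phi> x) auto
  also have "\<dots> = M * (LBINT s:{x..T}. \<bar>\<phi> s\<bar>)"
    using x by (simp add: set_lebesgue_integral_def)
  finally show ?thesis .
qed

text \<open>A bounded kernel maps an integrable function to a bounded one, and outside [0, T] the
  operator gives 0. Boundedness is what places the image in L2(0, T).\<close>

lemma volterra_bounded:
  obtains B where "\<And>x. \<bar>volterra T w \<phi> x\<bar> \<le> B"
proof -
  obtain M where M: "0 < M" "\<And>x s. 0 \<le> x \<Longrightarrow> x \<le> s \<Longrightarrow> s \<le> T \<Longrightarrow> \<bar>w x s\<bar> \<le> M"
    using triangle_bound[OF w] by blast
  have "\<bar>volterra T w \<phi> x\<bar> \<le> M * (LBINT s:{0..T}. \<bar>\<phi> s\<bar>)" for x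
  proof (cases "0 \<le> x \<and> x \<le> T")
    case True
    have "(LBINT s:{x..T}. \<bar>\<phi> s\<bar>) \<le> (LBINT s:{0..T}. \<bar>\<phi> s\<bar>)"
      unfolding set_lebesgue_integral_def using True integrable_abs_\<phi>[of x] integrable_abs_\<phi>[of 0]
      by (intro integral_mono) (auto simp: indicator_def)
    with abs_volterra_le[OF M(2), of x] True M(1) show ?thesis
      by (smt (verit) mult_left_mono)
  next
    case False
    then have "volterra T w \<phi> x = 0"
      unfolding volterra_def by (intro integral_eq_zero_AE) (auto simp: triangle_def indicator_def)
    moreover have "0 \<le> (LBINT s:{0..T}. \<bar>\<phi> s\<bar>)"
      unfolding set_lebesgue_integral_def by (rule Bochner_Integration.integral_nonneg) auto
    ultimately show ?thesis
      using M(1) by simp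
  qed
  with that show ?thesis .
qed

text \<open>Exchanging the order over the triangle \<open>0 \<le> x \<le> s \<le> T\<close> moves
  the operator from the control to \<open>y\<close>; the resulting inner integral is a wedge moment
  as in \<open>goursat_moment\<close>.\<close>

lemma volterra_fubini:
  assumes y: "continuous_on {0..T} y"
  shows "(LBINT x:{0..T}. y x * volterra T w \<phi> x) = (LBINT s:{0..T}. integral {0..s} (\<lambda>x. w x s * y x) * \<phi> s)"
    and "set_integrable lborel {0..T} (\<lambda>s. integral {0..s} (\<lambda>x. w x s * y x) * \<phi> s)"
proof -
  let ?f = "\<lambda>x s. (indicator {0..T} x * y x) * (indicator (triangle T) (x, s) * w x s * \<phi> s)"
  obtain M where M: "0 < M" "\<And>x s. 0 \<le> x \<Longrightarrow> x \<le> s \<Longrightarrow> s \<le> T \<Longrightarrow> \<bar>w x s\<bar> \<le> M"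
    using triangle_bound[OF w] by blast
  have ym: "(\<lambda>x. indicator {0..T} x * y x) \<in> borel_measurable borel"
    using borel_measurable_continuous_on_indicator[OF _ y] by simp
  have meas: "case_prod ?f \<in> borel_measurable (lborel \<Otimes>\<^sub>M lborel)"
  proof -
    have "(\<lambda>z. (indicator {0..T} (fst z) * y (fst z)) *
        (case z of (x, s) \<Rightarrow> indicator (triangle T) (x, s) * w x s * \<phi> s)) \<in> borel_measurable (lborel \<Otimes>\<^sub>M lborel)"
      using ym volterra_integrand_measurable by measurable
    then show ?thesis
      by (simp add: case_prod_beta')
  qed
  have yint: "integrable lborel (\<lambda>x. indicator {0..T} x * \<bar>y x\<bar>)"
    using set_integrable_abs[OF borel_integrable_atLeastAtMost'[OF y]] by (simp add: set_integrable_def)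
  \<comment> \<open>For \<open>x\<close> in [0, T] the inner absolute integral is at most
    \<open>M\<close> times the L1 norm of \<open>\<phi>\<close>, uniformly in \<open>x\<close>, so a
    multiple of the integrable function \<open>\<bar>y\<bar>\<close> dominates the outer
    integrand.\<close>
  have int: "integrable (lborel \<Otimes>\<^sub>M lborel) (case_prod ?f)"
  proof (rule lborel_pair.Fubini_integrable[OF meas])
    show "AE x in lborel. integrable lborel (\<lambda>s. case_prod ?f (x, s))"
      using volterra_integrand_integrable by (intro AE_I2) simp
    have "integrable lborel (\<lambda>x. indicator {0..T} x * \<bar>y x\<bar> *
        (LBINT s. \<bar>indicator (triangle T) (x, s) * w x s * \<phi> s\<bar>))"
    proof (rule Bochner_Integration.integrable_bound)
      show "integrable lborel (\<lambda>x. indicator {0..T} x * \<bar>y x\<bar> * (M * (LBINT s:{0..T}. \<bar>\<phi> s\<bar>)))"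
        using yint by simp
      have "(\<lambda>(x, s). \<bar>indicator (triangle T) (x, s) * w x s * \<phi> s\<bar>) \<in> borel_measurable (lborel \<Otimes>\<^sub>M lborel)"
        using borel_measurable_abs[OF volterra_integrand_measurable] by (simp add: case_prod_beta')
      from borel_measurable_times[OF borel_measurable_integrable[OF yint]
          lborel.borel_measurable_lebesgue_integral[OF this]]
      show "(\<lambda>x. indicator {0..T} x * \<bar>y x\<bar> *
        (LBINT s. \<bar>indicator (triangle T) (x, s) * w x s * \<phi> s\<bar>)) \<in> borel_measurable lborel"
        by simp
      have "(LBINT s. \<bar>indicator (triangle T) (x, s) * w x s * \<phi> s\<bar>) \<le> \<bar>M\<bar> * \<bar>LBINT s:{0..T}. \<bar>\<phi> s\<bar>\<bar>"
        if "x \<in> {0..T}" for x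
      proof -
        have "(LBINT s. \<bar>indicator (triangle T) (x, s) * w x s * \<phi> s\<bar>)
            \<le> (LBINT s. M * (indicator {0..T} s * \<bar>\<phi> s\<bar>))"
          using that M less_imp_le[OF M(1)]
          by (intro integral_mono integrable_abs volterra_integrand_integrable integrable_mult_right
            integrable_abs_\<phi>) (auto simp: indicator_def triangle_def abs_mult intro!: mult_right_mono mult_nonneg_nonneg)
        also have "\<dots> = M * (LBINT s:{0..T}. \<bar>\<phi> s\<bar>)"
          by (simp add: set_lebesgue_integral_def)
        also have "\<dots> \<le> \<bar>M\<bar> * \<bar>LBINT s:{0..T}. \<bar>\<phi> s\<bar>\<bar>"
          by (metis abs_ge_self abs_mult)
        finally show ?thesis .
      qed
      moreover have "0 \<le> (LBINT s. \<bar>indicator (triangle T) (x, s) * w x s * \<phi> s\<bar>)" for x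
        by (rule Bochner_Integration.integral_nonneg) auto
      ultimately show "AE x in lborel. norm (indicator {0..T} x * \<bar>y x\<bar> *
          (LBINT s. \<bar>indicator (triangle T) (x, s) * w x s * \<phi> s\<bar>))
        \<le> norm (indicator {0..T} x * \<bar>y x\<bar> * (M * (LBINT s:{0..T}. \<bar>\<phi> s\<bar>)))"
        by (intro AE_I2) (auto simp: indicator_def abs_mult intro!: mult_left_mono)
    qed
    then show "integrable lborel (\<lambda>x. LBINT s. norm (case_prod ?f (x, s)))"
      by (simp add: abs_mult)
  qed
  \<comment> \<open>For fixed \<open>s\<close> the triangle cuts the range of \<open>x\<close> down
    to \<open>{0..s}\<close>, where the integrand is continuous and the Lebesgue integral agrees
    with \<open>integral\<close>.\<close>
  have inner: "(LBINT x. ?f x s) = indicator {0..T} s *\<^sub>R (integral {0..s} (\<lambda>x. w x s * y x) * \<phi> s)" for s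
  proof (cases "s \<in> {0..T}")
    case True
    have "continuous_on {0..s} (\<lambda>x. case_prod w (x, s))"
      using True by (intro continuous_on_compose2[OF w] continuous_intros) (auto simp: triangle_def)
    then have cont: "continuous_on {0..s} (\<lambda>x. w x s * y x)"
      using True by (auto intro!: continuous_intros continuous_on_subset[OF y])
    have "(LBINT x. ?f x s) = (LBINT x. (indicator {0..s} x *\<^sub>R (w x s * y x)) * \<phi> s)"
      using True by (intro Bochner_Integration.integral_cong) (auto simp: indicator_def triangle_def)
    also have "\<dots> = (LBINT x:{0..s}. w x s * y x) * \<phi> s"
      by (simp add: set_lebesgue_integral_def)
    also have "(LBINT x:{0..s}. w x s * y x) = integral {0..s} (\<lambda>x. w x s * y x)"
      by (rule set_borel_integral_eq_integral(2)[OF borel_integrable_atLeastAtMost'[OF cont]])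
    finally show ?thesis
      using True by simp
  next
    case False
    then have "(\<lambda>x. ?f x s) = (\<lambda>x. 0)"
      by (auto simp: triangle_def indicator_def)
    with False show ?thesis
      by (simp only:) simp
  qed
  have "(LBINT x:{0..T}. y x * volterra T w \<phi> x) = (LBINT x. LBINT s. ?f x s)"
    by (simp add: set_lebesgue_integral_def volterra_def mult.assoc)
  also have "\<dots> = (LBINT s. LBINT x. ?f x s)"
    using lborel_pair.integral_fst[OF int] lborel_pair.integral_snd[OF int] by simp
  also have "\<dots> = (LBINT s:{0..T}. integral {0..s} (\<lambda>x. w x s * y x) * \<phi> s)"
    unfolding inner set_lebesgue_integral_def ..
  finally show "(LBINT x:{0..T}. y x * volterra T w \<phi> x) =
      (LBINT s:{0..T}. integral {0..s} (\<lambda>x. w x s * y x) * \<phi> s)" .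
  show "set_integrable lborel {0..T} (\<lambda>s. integral {0..s} (\<lambda>x. w x s * y x) * \<phi> s)"
    using lborel_pair.integrable_snd[OF int] unfolding inner set_integrable_def .
qed

end

section \<open>Volterra equations\<close>

text \<open>Banach's fixed point theorem for the rescaled unknown
  \<open>\<phi> t = exp (- l * t) *\<^sub>R f t\<close>. Values in a Banach space let one equation
  carry a system of two.\<close>

lemma volterra_equation_solvable:
  fixes K :: "real \<Rightarrow> real \<Rightarrow> 'a::banach \<Rightarrow> 'a" and b :: "real \<Rightarrow> 'a"
  assumes K: "continuous_on {(t, r, v). 0 \<le> r \<and> r \<le> t \<and> t \<le> T} (\<lambda>(t, r, v). K t r v)"
    and lipschitz: "\<And>t r u v. 0 \<le> r \<Longrightarrow> r \<le> t \<Longrightarrow> t \<le> T \<Longrightarrow> norm (K t r u - K t r v) \<le> M * norm (u - v)"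
    and M: "0 \<le> M" and b: "continuous_on {0..T} b" and T: "0 \<le> T"
  obtains f where "continuous_on {0..T} f"
    "\<And>t. 0 \<le> t \<Longrightarrow> t \<le> T \<Longrightarrow> f t = b t + integral {0..t} (\<lambda>r. K t r (f r))"
proof -
  \<comment> \<open>The exponential weight makes the integral operator a contraction on all of \<open>[0, T]\<close>.\<close>
  define l where "l = M + 1"
  have l: "0 < l"
    using M by (simp add: l_def)
  define \<Phi> where "\<Phi> \<phi> t = exp (- l * t) *\<^sub>R (b t + integral {0..t} (\<lambda>r. K t r (exp (l * r) *\<^sub>R \<phi> r)))"
    for \<phi> :: "real \<Rightarrow> 'a" and t
  have contK: "continuous_on {(r, t). 0 \<le> r \<and> r \<le> t \<and> t \<in> {0..T}}
      (\<lambda>(r, t). K t r (exp (l * r) *\<^sub>R \<phi> r))" if "continuous_on UNIV \<phi>" for \<phi>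
    unfolding case_prod_beta
    by (intro continuous_on_compose2[OF K, of _ "\<lambda>z. (snd z, fst z, exp (l * fst z) *\<^sub>R \<phi> (fst z))", simplified]
        continuous_intros continuous_on_compose2[OF that]) auto
  have slice: "(\<lambda>r. K t r (exp (l * r) *\<^sub>R \<phi> r)) integrable_on {0..t}"
    if "continuous_on UNIV \<phi>" "t \<in> {0..T}" for \<phi> t
    using that by (intro integrable_continuous_real
        continuous_on_compose2[OF contK[OF that(1)], of _ "\<lambda>r. (r, t)", simplified] continuous_intros) auto
  have cont: "continuous_on (cbox 0 T) (\<Phi> \<phi>)" if "continuous_on UNIV \<phi>" for \<phi>
  proof -
    have "continuous_on {0..T} (\<lambda>t. integral {0..t} (\<lambda>r. case (r, t) of (r, t) \<Rightarrow> K t r (exp (l * r) *\<^sub>R \<phi> r)))"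
      by (rule continuous_on_wedge_integral[OF contK[OF that]]) auto
    then show ?thesis
      unfolding \<Phi>_def by (auto intro!: continuous_intros b)
  qed
  \<comment> \<open>Composing with \<open>clamp 0 T\<close> extends \<open>\<Phi> \<phi>\<close> by
    its endpoint values to a bounded continuous function on the line, so the iteration acts on the
    complete space of such functions.\<close>
  have "\<exists>g :: real \<Rightarrow>\<^sub>C 'a. \<forall>t. g t = \<Phi> (apply_bcontfun \<phi>) (clamp 0 T t)" for \<phi>
    using continuous_on_cbox_bcontfunE[OF cont[OF continuous_on_apply_bcontfun]] by metis
  then obtain \<Psi> :: "(real \<Rightarrow>\<^sub>C 'a) \<Rightarrow> (real \<Rightarrow>\<^sub>C 'a)"
    where \<Psi>: "\<And>\<phi> t. \<Psi> \<phi> t = \<Phi> (apply_bcontfun \<phi>) (clamp 0 T t)"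
    by metis
  have contraction: "dist (\<Psi> \<phi>) (\<Psi> \<psi>) \<le> (M / l) * dist \<phi> \<psi>" for \<phi> \<psi>
  proof (rule dist_bound)
    fix s
    define t where "t = clamp 0 T s"
    have t: "0 \<le> t" "t \<le> T"
      using clamp_in_interval[of 0 T s] T by (auto simp: t_def)
    have cont\<phi>: "continuous_on UNIV (apply_bcontfun \<phi>)" "continuous_on UNIV (apply_bcontfun \<psi>)"
      by auto
    have exp_int: "((\<lambda>r. exp (l * r)) has_integral (exp (l * t) / l - exp (l * 0) / l)) {0..t}"
      by (rule fundamental_theorem_of_calculus[OF t(1)])
        (use l in \<open>auto intro!: derivative_eq_intros simp: has_real_derivative_iff_has_vector_derivative[symmetric]\<close>)
    have "dist (\<Psi> \<phi> s) (\<Psi> \<psi> s) = exp (- l * t) *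
        norm (integral {0..t} (\<lambda>r. K t r (exp (l * r) *\<^sub>R \<phi> r) - K t r (exp (l * r) *\<^sub>R \<psi> r)))"
      using slice[OF cont\<phi>(1), of t] slice[OF cont\<phi>(2), of t] t
      by (simp add: \<Psi> \<Phi>_def t_def[symmetric] dist_norm integral_diff flip: scaleR_diff_right)
    also have "\<dots> \<le> exp (- l * t) * integral {0..t} (\<lambda>r. M * dist \<phi> \<psi> * exp (l * r))"
    proof (intro mult_left_mono integral_norm_bound_integral)
      show "(\<lambda>r. K t r (exp (l * r) *\<^sub>R \<phi> r) - K t r (exp (l * r) *\<^sub>R \<psi> r)) integrable_on {0..t}"
        using slice[OF cont\<phi>(1), of t] slice[OF cont\<phi>(2), of t] t by (auto intro: integrable_diff)
      show "(\<lambda>r. M * dist \<phi> \<psi> * exp (l * r)) integrable_on {0..t}"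
        by (intro integrable_continuous_real continuous_intros)
      fix r assume r: "r \<in> {0..t}"
      have "norm (K t r (exp (l * r) *\<^sub>R \<phi> r) - K t r (exp (l * r) *\<^sub>R \<psi> r))
          \<le> M * norm (exp (l * r) *\<^sub>R \<phi> r - exp (l * r) *\<^sub>R \<psi> r)"
        using r t by (intro lipschitz) auto
      also have "\<dots> = M * dist (\<phi> r) (\<psi> r) * exp (l * r)"
        by (simp add: dist_norm flip: scaleR_diff_right)
      also have "\<dots> \<le> M * dist \<phi> \<psi> * exp (l * r)"
        by (intro mult_right_mono mult_left_mono dist_bounded M) simp
      finally show "norm (K t r (exp (l * r) *\<^sub>R \<phi> r) - K t r (exp (l * r) *\<^sub>R \<psi> r))
          \<le> M * dist \<phi> \<psi> * exp (l * r)" .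
    qed simp
    also have "\<dots> = M * dist \<phi> \<psi> * (exp (- l * t) * (exp (l * t) / l - 1 / l))"
      using exp_int by (simp add: integral_unique)
    \<comment> \<open>Here \<open>exp (- l * t) * (exp (l * t) / l - 1 / l)\<close> is
      \<open>(1 - exp (- l * t)) / l\<close>.\<close>
    also have "\<dots> \<le> M * dist \<phi> \<psi> * (1 / l)"
      using l M by (intro mult_left_mono) (simp_all add: field_simps flip: exp_add)
    finally show "dist (\<Psi> \<phi> s) (\<Psi> \<psi> s) \<le> (M / l) * dist \<phi> \<psi>"
      by simp
  qed
  \<comment> \<open>With \<open>l = M + 1\<close> the contraction factor \<open>M / l\<close> is
    below 1 for every \<open>T\<close>.\<close>
  have "\<exists>!\<phi>. \<Psi> \<phi> = \<phi>"
    by (rule banach_fix_type[of "M / l"]) (use contraction M l in \<open>auto simp: l_def\<close>)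
  then obtain \<phi> where \<phi>: "\<Psi> \<phi> = \<phi>"
    by blast
  have fixed_point: "\<phi> t = \<Phi> \<phi> t" if "0 \<le> t" "t \<le> T" for t
    using \<Psi>[of \<phi> t] that by (simp add: \<phi>)
  show ?thesis
  proof (rule that[of "\<lambda>t. exp (l * t) *\<^sub>R \<phi> t"])
    show "exp (l * t) *\<^sub>R \<phi> t = b t + integral {0..t} (\<lambda>r. K t r (exp (l * r) *\<^sub>R \<phi> r))"
      if "0 \<le> t" "t \<le> T" for t
      by (subst fixed_point[OF that]) (simp add: \<Phi>_def flip: exp_add)
  qed (intro continuous_intros continuous_on_apply_bcontfun)
qed

text \<open>As \<open>N\<close> is merely integrable, two tail integrals are taken: \<open>G\<close>
  of \<open>N\<close>, which is continuous, and \<open>H\<close> of \<open>G\<close>, which is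
  differentiable. Integrating the inequality gives \<open>G \<le> M * H\<close> at every point;
  hence \<open>exp (M * x) * H x\<close> is nondecreasing, and it vanishes at \<open>T\<close>. So
  \<open>H \<le> 0\<close>, then \<open>G \<le> 0\<close>, and the hypothesis forces
  \<open>N \<le> 0\<close> almost everywhere.\<close>

lemma backward_gronwall_AE:
  fixes N :: "real \<Rightarrow> real"
  assumes N: "set_integrable lborel {0..T} N" and nonneg: "\<And>x. 0 \<le> N x" and M: "0 \<le> M"
    and le: "AE x in lborel. x \<in> {0..T} \<longrightarrow> N x \<le> M * (LBINT s:{x..T}. N s)"
  shows "AE x in lborel. x \<in> {0..T} \<longrightarrow> N x = 0"
proof -
  define G where "G x = integral {x..T} N" for x
  define H where "H x = integral {x..T} G" for x
  have sub: "set_integrable lborel {x..T} N" if "0 \<le> x" for x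
    using that by (intro set_integrable_subset[OF N]) auto
  have G_eq: "(LBINT s:{x..T}. N s) = G x" if "0 \<le> x" for x
    unfolding G_def by (rule set_borel_integral_eq_integral(2)[OF sub[OF that]])
  have contG: "continuous_on {0..T} G"
    unfolding G_def using set_borel_integral_eq_integral(1)[OF N]
    by (rule indefinite_integral_continuous_1')
  have contH: "continuous_on {0..T} H"
    unfolding H_def using integrable_continuous_real[OF contG]
    by (rule indefinite_integral_continuous_1')
  have GH: "G x \<le> M * H x" if "0 \<le> x" for x
  proof -
    have intG: "set_integrable lborel {x..T} G"
      using that by (intro borel_integrable_atLeastAtMost' continuous_on_subset[OF contG]) auto
    have "G x = (LBINT s:{x..T}. N s)"
      using G_eq[OF that] by simp
    also have "\<dots> \<le> (LBINT s:{x..T}. M * G s)"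
    proof (rule set_integral_mono_AE[OF sub[OF that]])
      show "set_integrable lborel {x..T} (\<lambda>s. M * G s)"
        using intG by simp
      show "AE s\<in>{x..T} in lborel. N s \<le> M * G s"
        using le by eventually_elim (use that in \<open>auto simp: G_eq\<close>)
    qed
    also have "\<dots> = M * H x"
      unfolding H_def set_borel_integral_eq_integral(2)[OF intG, symmetric] by simp
    finally show ?thesis .
  qed
  have H: "H x \<le> 0" if x: "0 \<le> x" "x \<le> T" for x
  proof -
    have "exp (M * x) * H x \<le> exp (M * T) * H T"
    proof (rule DERIV_nonneg_imp_increasing_open[OF x(2)])
      fix s assume s: "x < s" "s < T"
      have "(H has_real_derivative - G s) (at s within {0..T})"
        unfolding H_def using contG by (rule integral_has_real_derivative') (use x s in auto)
      then have "(H has_real_derivative - G s) (at s)"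
        using at_within_Icc_at[of 0 s T] x s by simp
      then have "((\<lambda>s. exp (M * s) * H s) has_real_derivative exp (M * s) * (M * H s - G s)) (at s)"
        by (auto intro!: derivative_eq_intros simp: algebra_simps)
      then show "\<exists>y. ((\<lambda>s. exp (M * s) * H s) has_real_derivative y) (at s) \<and> 0 \<le> y"
        using GH[of s] x s by auto
    qed (use x in \<open>auto intro!: continuous_intros continuous_on_subset[OF contH]\<close>)
    then show ?thesis
      by (simp add: H_def mult_le_0_iff)
  qed
  show ?thesis
    using le
  proof eventually_elim
    fix x assume le: "x \<in> {0..T} \<longrightarrow> N x \<le> M * (LBINT s:{x..T}. N s)"
    show "x \<in> {0..T} \<longrightarrow> N x = 0"
    proof
      assume x: "x \<in> {0..T}"
      have "G x \<le> 0"
        using GH[of x] H[of x] x M by (smt (verit) atLeastAtMost_iff mult_nonneg_nonpos)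
      then have "N x \<le> 0"
        using le x M by (smt (verit) G_eq atLeastAtMost_iff mult_nonneg_nonpos)
      then show "N x = 0"
        using nonneg[of x] by simp
    qed
  qed
qed

section \<open>Square integrable functions and the branches of the wave\<close>

text \<open>The endpoints form a null set. Controls live on the open interval, while the Volterra
  estimates use the closed one.\<close>

lemma set_integrable_Icc_iff_Ioo:
  "set_integrable lborel {a<..<b} f \<longleftrightarrow> set_integrable lborel {a..b} f"
  for a b :: real and f :: "real \<Rightarrow> real"
  by (rule set_integrable_discrete_difference[where X="{a, b}"]) auto

lemma L2_on_Icc_iff_Ioo: "L2_on {a<..<b} f \<longleftrightarrow> L2_on {a..b} f"
  by (simp add: L2_on_def set_integrable_Icc_iff_Ioo)

lemma L2_on_times:
  assumes f: "L2_on S f" and g: "L2_on S g" and S: "S \<in> sets borel"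
  shows "set_integrable lborel S (\<lambda>x. f x * g x)"
proof (rule set_integrable_bound)
  show "set_integrable lborel S (\<lambda>x. (f x)\<^sup>2 + (g x)\<^sup>2)"
    using f g by (auto simp: L2_on_def)
  have [measurable]: "f \<in> borel_measurable borel" "g \<in> borel_measurable borel" "S \<in> sets borel"
    using f g S by (simp_all add: L2_on_def)
  show "set_borel_measurable lborel S (\<lambda>x. f x * g x)"
    unfolding set_borel_measurable_def by measurable
  have "\<bar>f x * g x\<bar> \<le> (f x)\<^sup>2 + (g x)\<^sup>2" for x
  proof -
    have "2 * \<bar>f x * g x\<bar> \<le> (f x)\<^sup>2 + (g x)\<^sup>2"
      using sum_squares_bound[of "\<bar>f x\<bar>" "\<bar>g x\<bar>"] by (simp add: abs_mult mult.assoc)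
    then show ?thesis
      by linarith
  qed
  then show "AE x in lborel. x \<in> S \<longrightarrow> norm (f x * g x) \<le> norm ((f x)\<^sup>2 + (g x)\<^sup>2)"
    by simp
qed

lemma L2_on_add:
  assumes f: "L2_on S f" and g: "L2_on S g" and S: "S \<in> sets borel"
  shows "L2_on S (\<lambda>x. f x + g x)"
  unfolding L2_on_def
proof
  show "(\<lambda>x. f x + g x) \<in> borel_measurable lborel"
    using f g by (auto simp: L2_on_def)
  have "set_integrable lborel S (\<lambda>x. (f x)\<^sup>2 + (g x)\<^sup>2 + 2 * (f x * g x))"
    using f g L2_on_times[OF f g S] by (auto simp: L2_on_def)
  then show "set_integrable lborel S (\<lambda>x. (f x + g x)\<^sup>2)"
    by (simp add: power2_sum mult.assoc)
qed

lemma L2_on_cmult: "L2_on S f \<Longrightarrow> L2_on S (\<lambda>x. c * f x)"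
  by (auto simp: L2_on_def power_mult_distrib)

lemma L2_on_diff:
  assumes "L2_on S f" "L2_on S g" "S \<in> sets borel"
  shows "L2_on S (\<lambda>x. f x - g x)"
  using L2_on_add[OF assms(1) L2_on_cmult[OF assms(2), of "-1"] assms(3)] by simp

lemma L2_on_bounded:
  assumes "f \<in> borel_measurable borel" and "\<And>x. x \<in> {a..b} \<Longrightarrow> \<bar>f x\<bar> \<le> B"
  shows "L2_on {a..b} f"
  unfolding L2_on_def
proof
  show "set_integrable lborel {a..b} (\<lambda>x. (f x)\<^sup>2)"
  proof (rule set_integrable_bound)
    show "set_integrable lborel {a..b} (\<lambda>x. B\<^sup>2)"
      by (intro borel_integrable_atLeastAtMost' continuous_intros)
    show "set_borel_measurable lborel {a..b} (\<lambda>x. (f x)\<^sup>2)"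
      using assms(1) unfolding set_borel_measurable_def by measurable
    show "AE x in lborel. x \<in> {a..b} \<longrightarrow> norm ((f x)\<^sup>2) \<le> norm (B\<^sup>2)"
      using power_mono[OF assms(2), of _ 2] by simp
  qed
qed (use assms in simp)

lemma L2_on_continuous:
  assumes "f \<in> borel_measurable borel" and "continuous_on {a..b} f"
  shows "L2_on {a..b} f"
proof -
  have "bounded (f ` {a..b})"
    using assms(2) by (intro compact_imp_bounded compact_continuous_image) auto
  then obtain B where "\<forall>x\<in>{a..b}. \<bar>f x\<bar> \<le> B"
    by (auto simp: bounded_iff)
  then show ?thesis
    using L2_on_bounded[OF assms(1), of a b B] by blast
qed

lemma L2_on_imp_integrable:
  assumes "L2_on {a..b} f"
  shows "set_integrable lborel {a..b} f"
  using L2_on_times[OF assms L2_on_continuous[of "\<lambda>_. 1"]] by simp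

lemma L2_on_reflect: "L2_on {0..T} f \<Longrightarrow> L2_on {0..T} (\<lambda>s. f (T - s))"
  using lborel_integrable_real_affine[of "\<lambda>x. indicator {0..T} x *\<^sub>R (f x)\<^sup>2" "-1" T]
  by (auto simp: L2_on_def set_integrable_def indicator_def of_bool_def cong: if_cong
      elim!: Bochner_Integration.integrable_cong[THEN iffD1, rotated 2])

lemma set_integral_reflect_Icc:
  "(LBINT s:{0..T}. f (T - s)) = (LBINT s:{0..T}. f s)" for f :: "real \<Rightarrow> real"
  unfolding set_lebesgue_integral_def
  by (subst (2) lborel_integral_real_affine[of "-1" _ T])
    (auto intro!: Bochner_Integration.integral_cong simp: indicator_def)

lemma symmetric_interval_integral:
  fixes h :: "real \<Rightarrow> real"
  assumes T: "0 \<le> T"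
    and h: "set_integrable lborel {0..T} h" "set_integrable lborel {0..T} (\<lambda>x. h (- x))"
  shows "(LBINT x=-T..T. h x) = (LBINT x:{0..T}. h x) + (LBINT x:{0..T}. h (- x))"
proof -
  have refl: "{x. - x \<in> {- T..0}} = {0..T}"
    by auto
  have "set_integrable lborel {- T..0} h"
  proof -
    have "(\<lambda>x. indicator {0..T} (0 + - 1 * x) *\<^sub>R h (- (0 + - 1 * x))) = (\<lambda>x. indicator {- T..0} x *\<^sub>R h x)"
      by (auto simp: fun_eq_iff indicator_def)
    then show ?thesis
      using h(2) lborel_integrable_real_affine[of "\<lambda>x. indicator {0..T} x *\<^sub>R h (- x)" "-1" 0]
      unfolding set_integrable_def by simp
  qed
  moreover have "{- T..T} = {- T..0} \<union> {0..T}"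
    using T by auto
  \<comment> \<open>The two halves overlap only in the null set {0}.\<close>
  moreover have "AE x in lborel. \<not> (x \<in> {- T..0} \<and> x \<in> {0..T})"
    using AE_lborel_singleton[of 0] by eventually_elim auto
  ultimately have "(LBINT x:{- T..T}. h x) = (LBINT x:{- T..0}. h x) + (LBINT x:{0..T}. h x)"
    using h(1) by (simp add: set_integral_Un_AE)
  also have "(LBINT x:{- T..0}. h x) = (LBINT x:{0..T}. h (- x))"
    by (subst set_integral_reflect) (simp only: refl)
  finally show ?thesis
    using T interval_integral_Icc[of "- T" T h] by simp
qed

text \<open>The values of \<open>W F\<close> on one half-line, as a function of the distance \<open>x\<close> to the origin; the arguments
  \<open>\<phi>1\<close>, \<open>\<phi>2\<close> are the controls in reversed time \<open>s \<mapsto> T - s\<close>.\<close>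

definition branch where
  "branch T a b v1 v2 \<phi>1 \<phi>2 x = a * \<phi>1 x + b * \<phi>2 x + volterra T v1 \<phi>1 x + volterra T v2 \<phi>2 x"

lemma L2_on_volterra:
  assumes w: "continuous_on (triangle T) (case_prod w)" and \<phi>: "L2_on {0..T} \<phi>"
  shows "L2_on {0..T} (volterra T w \<phi>)"
proof -
  have m: "\<phi> \<in> borel_measurable borel"
    using \<phi> by (simp add: L2_on_def)
  obtain B where "\<And>x. \<bar>volterra T w \<phi> x\<bar> \<le> B"
    using volterra_bounded[OF w L2_on_imp_integrable[OF \<phi>] m] by blast
  then show ?thesis
    using L2_on_bounded[OF volterra_measurable[OF w L2_on_imp_integrable[OF \<phi>] m]] by blast
qed

context
  fixes T :: real and v1 v2 :: "real \<Rightarrow> real \<Rightarrow> real"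
  assumes v: "continuous_on (triangle T) (case_prod v1)" "continuous_on (triangle T) (case_prod v2)"
begin

lemma L2_on_branch:
  assumes "L2_on {0..T} \<phi>1" "L2_on {0..T} \<phi>2"
  shows "L2_on {0..T} (branch T a b v1 v2 \<phi>1 \<phi>2)"
  unfolding branch_def[abs_def]
  using assms v by (intro L2_on_add L2_on_cmult L2_on_volterra) auto

lemma branch_diff:
  assumes \<phi>: "L2_on {0..T} \<phi>1" "L2_on {0..T} \<phi>2" and \<psi>: "L2_on {0..T} \<psi>1" "L2_on {0..T} \<psi>2"
  shows "branch T a b v1 v2 (\<lambda>s. \<phi>1 s - \<psi>1 s) (\<lambda>s. \<phi>2 s - \<psi>2 s) x
    = branch T a b v1 v2 \<phi>1 \<phi>2 x - branch T a b v1 v2 \<psi>1 \<psi>2 x"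
proof -
  have "volterra T w (\<lambda>s. f s - g s) x = volterra T w f x - volterra T w g x"
    if w: "continuous_on (triangle T) (case_prod w)" and f: "L2_on {0..T} f" and g: "L2_on {0..T} g" for w f g
  proof -
    have m: "f \<in> borel_measurable borel" "g \<in> borel_measurable borel"
      using f g by (simp_all add: L2_on_def)
    show ?thesis
      unfolding volterra_def right_diff_distrib
      using volterra_integrand_integrable[OF w L2_on_imp_integrable[OF f] m(1)]
        volterra_integrand_integrable[OF w L2_on_imp_integrable[OF g] m(2)]
      by (rule Bochner_Integration.integral_diff)
  qed
  then show ?thesis
    using v assms by (simp add: branch_def algebra_simps)
qed

text \<open>This is the adjoint of \<open>branch\<close> applied to \<open>y\<close>: each control
  component is weighted by its front amplitude times \<open>y\<close> plus a wedge moment of its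
  kernel. Adding the weights of the two half-lines later produces the expression in
  \<open>goursat_moment\<close>.\<close>

lemma branch_moment:
  assumes \<phi>: "L2_on {0..T} \<phi>1" "L2_on {0..T} \<phi>2" and y: "continuous_on {0..T} y"
  shows "(LBINT x:{0..T}. y x * branch T a b v1 v2 \<phi>1 \<phi>2 x) =
      (LBINT s:{0..T}. (a * y s + integral {0..s} (\<lambda>x. v1 x s * y x)) * \<phi>1 s)
    + (LBINT s:{0..T}. (b * y s + integral {0..s} (\<lambda>x. v2 x s * y x)) * \<phi>2 s)"
    and "set_integrable lborel {0..T} (\<lambda>s. (a * y s + integral {0..s} (\<lambda>x. v1 x s * y x)) * \<phi>1 s)"
    and "set_integrable lborel {0..T} (\<lambda>s. (b * y s + integral {0..s} (\<lambda>x. v2 x s * y x)) * \<phi>2 s)"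
proof -
  have m: "\<phi>1 \<in> borel_measurable borel" "\<phi>2 \<in> borel_measurable borel"
    using \<phi> by (simp_all add: L2_on_def)
  note fub1 = volterra_fubini[OF v(1) L2_on_imp_integrable[OF \<phi>(1)] m(1) y]
  note fub2 = volterra_fubini[OF v(2) L2_on_imp_integrable[OF \<phi>(2)] m(2) y]
  \<comment> \<open>\<open>L2_on\<close> asks for measurability on the whole line, whereas
    \<open>y\<close> is known to be continuous on [0, T]; extension by 0 bridges this.\<close>
  have y2: "L2_on {0..T} (\<lambda>x. indicator {0..T} x * y x)"
    using borel_measurable_continuous_on_indicator[OF _ y]
    by (intro L2_on_continuous continuous_on_eq[OF y]) auto
  have yint: "set_integrable lborel {0..T} (\<lambda>x. y x * f x)" if "L2_on {0..T} f" for f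
    using L2_on_times[OF y2 that]
    by (auto simp: set_integrable_def indicator_def elim!: Bochner_Integration.integrable_cong[THEN iffD1, rotated 2])
  note i = yint[OF \<phi>(1)] yint[OF \<phi>(2)] yint[OF L2_on_volterra[OF v(1) \<phi>(1)]] yint[OF L2_on_volterra[OF v(2) \<phi>(2)]]
  have "(LBINT x:{0..T}. y x * branch T a b v1 v2 \<phi>1 \<phi>2 x)
      = (LBINT x:{0..T}. (a * (y x * \<phi>1 x) + b * (y x * \<phi>2 x))
        + (y x * volterra T v1 \<phi>1 x + y x * volterra T v2 \<phi>2 x))"
    by (simp add: branch_def algebra_simps)
  also have "\<dots> = a * (LBINT x:{0..T}. y x * \<phi>1 x) + b * (LBINT x:{0..T}. y x * \<phi>2 x)
      + ((LBINT x:{0..T}. y x * volterra T v1 \<phi>1 x) + (LBINT x:{0..T}. y x * volterra T v2 \<phi>2 x))"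
    using i by (simp add: set_integral_add)
  finally have 1: "(LBINT x:{0..T}. y x * branch T a b v1 v2 \<phi>1 \<phi>2 x) = \<dots>" .
  have 2: "set_integrable lborel {0..T} (\<lambda>s. c * (y s * \<phi> s) + J s * \<phi> s)"
      "(LBINT s:{0..T}. c * (y s * \<phi> s) + J s * \<phi> s)
        = c * (LBINT s:{0..T}. y s * \<phi> s) + (LBINT s:{0..T}. J s * \<phi> s)"
    if "set_integrable lborel {0..T} (\<lambda>s. y s * \<phi> s)" "set_integrable lborel {0..T} (\<lambda>s. J s * \<phi> s)" for c \<phi> J
    using that by (simp_all add: set_integral_add)
  show "(LBINT x:{0..T}. y x * branch T a b v1 v2 \<phi>1 \<phi>2 x) =
      (LBINT s:{0..T}. (a * y s + integral {0..s} (\<lambda>x. v1 x s * y x)) * \<phi>1 s)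
    + (LBINT s:{0..T}. (b * y s + integral {0..s} (\<lambda>x. v2 x s * y x)) * \<phi>2 s)"
    unfolding 1 distrib_right mult.assoc 2(2)[OF i(1) fub1(2)] 2(2)[OF i(2) fub2(2)] fub1(1) fub2(1)
    by simp
  show "set_integrable lborel {0..T} (\<lambda>s. (a * y s + integral {0..s} (\<lambda>x. v1 x s * y x)) * \<phi>1 s)"
    "set_integrable lborel {0..T} (\<lambda>s. (b * y s + integral {0..s} (\<lambda>x. v2 x s * y x)) * \<phi>2 s)"
    using 2(1)[OF i(1) fub1(2)] 2(1)[OF i(2) fub2(2)] by (simp_all add: distrib_right mult.assoc)
qed

end

text \<open>The amplitude matrix is invertible: right minus left isolates \<open>\<phi>1\<close>,
  right plus left isolates \<open>- \<phi>2\<close>, each up to Volterra terms. The sum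
  \<open>N\<close> of the absolute values is thereby bounded by its own tail integral, and Gronwall
  applies.\<close>

lemma branches_injective:
  assumes v: "continuous_on (triangle T) (case_prod v1)" "continuous_on (triangle T) (case_prod v2)"
    and u: "continuous_on (triangle T) (case_prod u1)" "continuous_on (triangle T) (case_prod u2)"
    and \<phi>: "L2_on {0..T} \<phi>1" "L2_on {0..T} \<phi>2"
    and zero: "AE x in lborel. x \<in> {0..T} \<longrightarrow> branch T (1/2) (-1/2) v1 v2 \<phi>1 \<phi>2 x = 0"
      "AE x in lborel. x \<in> {0..T} \<longrightarrow> branch T (-1/2) (-1/2) u1 u2 \<phi>1 \<phi>2 x = 0"
  shows "AE x in lborel. x \<in> {0..T} \<longrightarrow> \<phi>1 x = 0 \<and> \<phi>2 x = 0"
proof -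
  have m: "\<phi>1 \<in> borel_measurable borel" "\<phi>2 \<in> borel_measurable borel"
    using \<phi> by (simp_all add: L2_on_def)
  note i = L2_on_imp_integrable[OF \<phi>(1)] L2_on_imp_integrable[OF \<phi>(2)]
  define N where "N x = \<bar>\<phi>1 x\<bar> + \<bar>\<phi>2 x\<bar>" for x
  have N: "set_integrable lborel {0..T} N"
    unfolding N_def using i by (intro set_integral_add set_integrable_abs)
  have le: "\<exists>M\<ge>0. \<forall>x\<in>{0..T}. \<bar>volterra T w \<phi> x\<bar> \<le> M * (LBINT s:{x..T}. N s)"
    if w: "continuous_on (triangle T) (case_prod w)" and \<phi>: "\<phi> = \<phi>1 \<or> \<phi> = \<phi>2" for w \<phi>
  proof -
    obtain M where M: "0 < M" "\<And>x s. 0 \<le> x \<Longrightarrow> x \<le> s \<Longrightarrow> s \<le> T \<Longrightarrow> \<bar>w x s\<bar> \<le> M"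
      using triangle_bound[OF w] by blast
    have \<phi>i: "set_integrable lborel {0..T} \<phi>" and \<phi>m: "\<phi> \<in> borel_measurable borel"
      using \<phi> i m by auto
    have "\<bar>volterra T w \<phi> x\<bar> \<le> M * (LBINT s:{x..T}. N s)" if x: "x \<in> {0..T}" for x
    proof -
      have "\<bar>volterra T w \<phi> x\<bar> \<le> M * (LBINT s:{x..T}. \<bar>\<phi> s\<bar>)"
        using abs_volterra_le[OF w \<phi>i \<phi>m M(2)] x by simp
      also have "\<dots> \<le> M * (LBINT s:{x..T}. N s)"
      proof (intro mult_left_mono set_integral_mono)
        show "set_integrable lborel {x..T} (\<lambda>s. \<bar>\<phi> s\<bar>)" "set_integrable lborel {x..T} N"
          using x by (auto intro!: set_integrable_abs set_integrable_subset[OF \<phi>i] set_integrable_subset[OF N])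
        show "\<bar>\<phi> s\<bar> \<le> N s" for s
          using \<phi> by (auto simp: N_def)
      qed (use M in simp)
      finally show ?thesis .
    qed
    with M(1) show ?thesis
      by (intro exI[of _ M]) auto
  qed
  obtain M1 where M1: "0 \<le> M1" "\<And>x. x \<in> {0..T} \<Longrightarrow> \<bar>volterra T v1 \<phi>1 x\<bar> \<le> M1 * (LBINT s:{x..T}. N s)"
    using le[OF v(1)] by blast
  obtain M2 where M2: "0 \<le> M2" "\<And>x. x \<in> {0..T} \<Longrightarrow> \<bar>volterra T v2 \<phi>2 x\<bar> \<le> M2 * (LBINT s:{x..T}. N s)"
    using le[OF v(2)] by blast
  obtain M3 where M3: "0 \<le> M3" "\<And>x. x \<in> {0..T} \<Longrightarrow> \<bar>volterra T u1 \<phi>1 x\<bar> \<le> M3 * (LBINT s:{x..T}. N s)"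
    using le[OF u(1)] by blast
  obtain M4 where M4: "0 \<le> M4" "\<And>x. x \<in> {0..T} \<Longrightarrow> \<bar>volterra T u2 \<phi>2 x\<bar> \<le> M4 * (LBINT s:{x..T}. N s)"
    using le[OF u(2)] by blast
  \<comment> \<open>The factor 2 arises because every Volterra term enters both the difference and
    the sum of the branches.\<close>
  have "AE x in lborel. x \<in> {0..T} \<longrightarrow> N x \<le> 2 * (M1 + M2 + M3 + M4) * (LBINT s:{x..T}. N s)"
    using zero
  proof eventually_elim
    case (elim x)
    show ?case
    proof
      assume x: "x \<in> {0..T}"
      have "N x \<le> 2 * (\<bar>volterra T v1 \<phi>1 x\<bar> + \<bar>volterra T v2 \<phi>2 x\<bar>
          + \<bar>volterra T u1 \<phi>1 x\<bar> + \<bar>volterra T u2 \<phi>2 x\<bar>)"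
        using elim x unfolding N_def branch_def by auto
      also have "\<dots> \<le> 2 * (M1 * (LBINT s:{x..T}. N s) + M2 * (LBINT s:{x..T}. N s)
          + M3 * (LBINT s:{x..T}. N s) + M4 * (LBINT s:{x..T}. N s))"
        using M1(2)[OF x] M2(2)[OF x] M3(2)[OF x] M4(2)[OF x] by simp
      finally show "N x \<le> 2 * (M1 + M2 + M3 + M4) * (LBINT s:{x..T}. N s)"
        by (simp add: algebra_simps)
    qed
  qed
  from backward_gronwall_AE[OF N _ _ this]
  have "AE x in lborel. x \<in> {0..T} \<longrightarrow> N x = 0"
    using M1(1) M2(1) M3(1) M4(1) by (simp add: N_def)
  then show ?thesis
    by eventually_elim (auto simp: N_def)
qed

text \<open>Difference and sum of the branch equations put the system in the form "unknown = data +
  Volterra term". With \<open>t = T - x\<close> the tail integrals become integrals from 0 to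
  \<open>t\<close>, as \<open>volterra_equation_solvable\<close> requires.\<close>

lemma branches_solvable:
  assumes T: "0 \<le> T"
    and v: "continuous_on (triangle T) (case_prod v1)" "continuous_on (triangle T) (case_prod v2)"
    and u: "continuous_on (triangle T) (case_prod u1)" "continuous_on (triangle T) (case_prod u2)"
    and p: "continuous_on {0..T} p" and m: "continuous_on {0..T} m"
  obtains \<phi>1 \<phi>2 where "L2_on {0..T} \<phi>1" "L2_on {0..T} \<phi>2"
    "\<And>x. x \<in> {0..T} \<Longrightarrow> branch T (1/2) (-1/2) v1 v2 \<phi>1 \<phi>2 x = p x"
    "\<And>x. x \<in> {0..T} \<Longrightarrow> branch T (-1/2) (-1/2) u1 u2 \<phi>1 \<phi>2 x = m x"
proof -
  let ?k = "\<lambda>w t r. w (T - t) (T - r) :: real"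
  \<comment> \<open>The first component comes from right minus left and the second from the negative
    of their sum; this fixes the signs in \<open>K\<close> and in \<open>b\<close>.\<close>
  define K where "K t r z =
      (?k u1 t r * fst z + ?k u2 t r * snd z - (?k v1 t r * fst z + ?k v2 t r * snd z),
       ?k v1 t r * fst z + ?k v2 t r * snd z + (?k u1 t r * fst z + ?k u2 t r * snd z))"
    for t r :: real and z :: "real \<times> real"
  define b where "b t = (p (T - t) - m (T - t), - (p (T - t) + m (T - t)))" for t
  have kcont: "continuous_on {(t, r, z :: real \<times> real). 0 \<le> r \<and> r \<le> t \<and> t \<le> T} (\<lambda>x. ?k w (fst x) (fst (snd x)))"
    if "continuous_on (triangle T) (case_prod w)" for w
    by (intro continuous_on_compose2[OF that, of _ "\<lambda>x. (T - fst x, T - fst (snd x))", simplified] continuous_intros)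
      (auto simp: triangle_def)
  note kc = kcont[OF u(1)] kcont[OF u(2)] kcont[OF v(1)] kcont[OF v(2)]
  have K: "continuous_on {(t, r, z). 0 \<le> r \<and> r \<le> t \<and> t \<le> T} (\<lambda>(t, r, z). K t r z)"
    unfolding K_def case_prod_beta by (intro continuous_intros kc[unfolded case_prod_beta])
  obtain M1 where M1: "0 < M1" "\<And>x s. 0 \<le> x \<Longrightarrow> x \<le> s \<Longrightarrow> s \<le> T \<Longrightarrow> \<bar>v1 x s\<bar> \<le> M1"
    using triangle_bound[OF v(1)] by blast
  obtain M2 where M2: "0 < M2" "\<And>x s. 0 \<le> x \<Longrightarrow> x \<le> s \<Longrightarrow> s \<le> T \<Longrightarrow> \<bar>v2 x s\<bar> \<le> M2"
    using triangle_bound[OF v(2)] by blast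
  obtain M3 where M3: "0 < M3" "\<And>x s. 0 \<le> x \<Longrightarrow> x \<le> s \<Longrightarrow> s \<le> T \<Longrightarrow> \<bar>u1 x s\<bar> \<le> M3"
    using triangle_bound[OF u(1)] by blast
  obtain M4 where M4: "0 < M4" "\<And>x s. 0 \<le> x \<Longrightarrow> x \<le> s \<Longrightarrow> s \<le> T \<Longrightarrow> \<bar>u2 x s\<bar> \<le> M4"
    using triangle_bound[OF u(2)] by blast
  have lipschitz: "norm (K t r z - K t r z') \<le> 2 * (M1 + M2 + M3 + M4) * norm (z - z')"
    if "0 \<le> r" "r \<le> t" "t \<le> T" for t r z z'
  proof -
    have abs4: "norm (a1 + a2 - (a3 + a4)) + norm (a3 + a4 + (a1 + a2)) \<le> 2 * (\<bar>a3\<bar> + \<bar>a4\<bar> + \<bar>a1\<bar> + \<bar>a2\<bar>)"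
      for a1 a2 a3 a4 :: real
      unfolding real_norm_def by (smt (verit))
    define d e where "d = fst (z - z')" and "e = snd (z - z')"
    have de: "\<bar>d\<bar> \<le> norm (z - z')" "\<bar>e\<bar> \<le> norm (z - z')"
      using norm_fst_le[of d e] norm_snd_le[of e d]
      unfolding d_def e_def prod.collapse by (simp_all only: real_norm_def)
    have entry_le: "\<bar>?k w t r * c\<bar> \<le> M * norm (z - z')"
      if "\<And>x s. 0 \<le> x \<Longrightarrow> x \<le> s \<Longrightarrow> s \<le> T \<Longrightarrow> \<bar>w x s\<bar> \<le> M" "0 < M" "\<bar>c\<bar> \<le> norm (z - z')" for w M c
      using that(1)[of "T - t" "T - r"] \<open>0 \<le> r\<close> \<open>r \<le> t\<close> \<open>t \<le> T\<close> that(2,3)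
      unfolding abs_mult by (intro mult_mono) auto
    have "norm (K t r z - K t r z') \<le> norm (fst (K t r z - K t r z')) + norm (snd (K t r z - K t r z'))"
      by (metis norm_Pair_le prod.collapse)
    also have "fst (K t r z - K t r z') = ?k u1 t r * d + ?k u2 t r * e - (?k v1 t r * d + ?k v2 t r * e)"
      by (simp add: K_def d_def e_def algebra_simps)
    also have "snd (K t r z - K t r z') = ?k v1 t r * d + ?k v2 t r * e + (?k u1 t r * d + ?k u2 t r * e)"
      by (simp add: K_def d_def e_def algebra_simps)
    also have "norm (?k u1 t r * d + ?k u2 t r * e - (?k v1 t r * d + ?k v2 t r * e))
        + norm (?k v1 t r * d + ?k v2 t r * e + (?k u1 t r * d + ?k u2 t r * e))
        \<le> 2 * (\<bar>?k v1 t r * d\<bar> + \<bar>?k v2 t r * e\<bar> + \<bar>?k u1 t r * d\<bar> + \<bar>?k u2 t r * e\<bar>)"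
      by (rule abs4)
    also have "\<dots> \<le> 2 * (M1 * norm (z - z') + M2 * norm (z - z') + M3 * norm (z - z') + M4 * norm (z - z'))"
      by (intro mult_left_mono add_mono entry_le M1 M2 M3 M4 de) auto
    finally show ?thesis
      by (simp add: algebra_simps)
  qed
  have b: "continuous_on {0..T} b"
    unfolding b_def by (intro continuous_intros continuous_on_compose2[OF p] continuous_on_compose2[OF m]) auto
  have "0 \<le> 2 * (M1 + M2 + M3 + M4)"
    using M1 M2 M3 M4 by simp
  then obtain f where f: "continuous_on {0..T} f"
    "\<And>t. 0 \<le> t \<Longrightarrow> t \<le> T \<Longrightarrow> f t = b t + integral {0..t} (\<lambda>r. K t r (f r))"
    using volterra_equation_solvable[OF K lipschitz _ b T] by blast
  \<comment> \<open>The solution \<open>f\<close> is controlled on [0, T] alone; cutting off by the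
    indicator makes its reversal Borel on the line.\<close>
  define \<phi>1 where "\<phi>1 s = indicator {0..T} s *\<^sub>R fst (f (T - s))" for s
  define \<phi>2 where "\<phi>2 s = indicator {0..T} s *\<^sub>R snd (f (T - s))" for s
  have fcont: "continuous_on {0..T} (\<lambda>s. fst (f (T - s)))" "continuous_on {0..T} (\<lambda>s. snd (f (T - s)))"
    by (intro continuous_intros continuous_on_compose2[OF f(1)]; auto)+
  have \<phi>: "L2_on {0..T} \<phi>1" "L2_on {0..T} \<phi>2"
    unfolding \<phi>1_def \<phi>2_def
    by (intro L2_on_continuous borel_measurable_continuous_on_indicator fcont
        continuous_on_eq[OF fcont(1)] continuous_on_eq[OF fcont(2)]; simp)+
  have slice: "continuous_on {0..t} (\<lambda>r. ?k w t r * g (f r))"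
    if w: "continuous_on (triangle T) (case_prod w)" and g: "continuous_on UNIV g" and t: "t \<in> {0..T}"
    for w t and g :: "real \<times> real \<Rightarrow> real"
  proof -
    have "continuous_on {0..t} (\<lambda>r. case_prod w (T - t, T - r))"
      using t by (intro continuous_on_compose2[OF w] continuous_intros) (auto simp: triangle_def)
    moreover have "continuous_on {0..t} (\<lambda>r. g (f r))"
      using t by (intro continuous_on_compose2[OF g] continuous_on_subset[OF f(1)]) auto
    ultimately show ?thesis
      by (auto intro: continuous_on_mult)
  qed
  \<comment> \<open>The substitution \<open>s = T - r\<close> maps the slice \<open>{x..T}\<close>
    of the triangle to \<open>{0..T - x}\<close>.\<close>
  have volt: "volterra T w (\<lambda>s. indicator {0..T} s *\<^sub>R g (f (T - s))) x = integral {0..T - x} (\<lambda>r. ?k w (T - x) r * g (f r))"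
    if w: "continuous_on (triangle T) (case_prod w)" and g: "continuous_on UNIV g" and x: "x \<in> {0..T}"
    for w x and g :: "real \<times> real \<Rightarrow> real"
  proof -
    have "volterra T w (\<lambda>s. indicator {0..T} s *\<^sub>R g (f (T - s))) x
        = (LBINT s. indicator (triangle T) (x, s) * w x s * (indicator {0..T} s *\<^sub>R g (f (T - s))))"
      by (simp add: volterra_def)
    also have "\<dots> = (LBINT r. indicator {0..T - x} r *\<^sub>R (?k w (T - x) r * g (f r)))"
      using x by (subst lborel_integral_real_affine[of "-1" _ T])
        (auto intro!: Bochner_Integration.integral_cong simp: indicator_def triangle_def)
    also have "\<dots> = integral {0..T - x} (\<lambda>r. ?k w (T - x) r * g (f r))"
      using set_borel_integral_eq_integral(2)[OF borel_integrable_atLeastAtMost'[OF slice[OF w g, of "T - x"]]] x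
      by (simp add: set_lebesgue_integral_def)
    finally show ?thesis .
  qed
  have cfs: "continuous_on UNIV (fst :: real \<times> real \<Rightarrow> real)" "continuous_on UNIV (snd :: real \<times> real \<Rightarrow> real)"
    by (intro continuous_intros)+
  have sys: "fst (f (T - x)) = p x - m x + (volterra T u1 \<phi>1 x + volterra T u2 \<phi>2 x - (volterra T v1 \<phi>1 x + volterra T v2 \<phi>2 x))"
    "snd (f (T - x)) = - (p x + m x) + (volterra T v1 \<phi>1 x + volterra T v2 \<phi>2 x + (volterra T u1 \<phi>1 x + volterra T u2 \<phi>2 x))"
    if x: "x \<in> {0..T}" for x
  proof -
    have t: "T - x \<in> {0..T}"
      using x by auto
    note i = slice[OF u(1) cfs(1) t, THEN integrable_continuous_real] slice[OF u(2) cfs(2) t, THEN integrable_continuous_real]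
      slice[OF v(1) cfs(1) t, THEN integrable_continuous_real] slice[OF v(2) cfs(2) t, THEN integrable_continuous_real]
    \<comment> \<open>A planar integral is assembled from its components through the two linear
      embeddings of the line, since \<open>f\<close> solves an equation between pairs.\<close>
    have pair: "((\<lambda>r. (g r, h r)) has_integral (I, J)) {0..T - x}"
      if "(g has_integral I) {0..T - x}" "(h has_integral J) {0..T - x}" for g h :: "real \<Rightarrow> real" and I J
    proof -
      have "bounded_linear (\<lambda>a :: real. (a, 0 :: real))" "bounded_linear (\<lambda>a :: real. (0 :: real, a))"
        by (intro bounded_linear_Pair bounded_linear_ident bounded_linear_zero)+
      from has_integral_add[OF has_integral_linear[OF that(1) this(1)] has_integral_linear[OF that(2) this(2)]]
      show ?thesis
        by (simp add: o_def)
    qed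
    have "((\<lambda>r. K (T - x) r (f r)) has_integral
       (volterra T u1 \<phi>1 x + volterra T u2 \<phi>2 x - (volterra T v1 \<phi>1 x + volterra T v2 \<phi>2 x),
        volterra T v1 \<phi>1 x + volterra T v2 \<phi>2 x + (volterra T u1 \<phi>1 x + volterra T u2 \<phi>2 x))) {0..T - x}"
      unfolding K_def \<phi>1_def \<phi>2_def volt[OF u(1) cfs(1) x] volt[OF u(2) cfs(2) x] volt[OF v(1) cfs(1) x] volt[OF v(2) cfs(2) x]
      by (intro pair has_integral_add has_integral_diff integrable_integral i)
    then have "f (T - x) = b (T - x) +
       (volterra T u1 \<phi>1 x + volterra T u2 \<phi>2 x - (volterra T v1 \<phi>1 x + volterra T v2 \<phi>2 x),
        volterra T v1 \<phi>1 x + volterra T v2 \<phi>2 x + (volterra T u1 \<phi>1 x + volterra T u2 \<phi>2 x))"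
      using f(2)[of "T - x"] t by (simp add: integral_unique)
    then show "fst (f (T - x)) = p x - m x + (volterra T u1 \<phi>1 x + volterra T u2 \<phi>2 x - (volterra T v1 \<phi>1 x + volterra T v2 \<phi>2 x))"
      "snd (f (T - x)) = - (p x + m x) + (volterra T v1 \<phi>1 x + volterra T v2 \<phi>2 x + (volterra T u1 \<phi>1 x + volterra T u2 \<phi>2 x))"
      by (simp_all add: b_def)
  qed
  show ?thesis
  proof (rule that[OF \<phi>])
    fix x assume x: "x \<in> {0..T}"
    then have "\<phi>1 x = fst (f (T - x))" "\<phi>2 x = snd (f (T - x))"
      by (simp_all add: \<phi>1_def \<phi>2_def)
    then show "branch T (1/2) (-1/2) v1 v2 \<phi>1 \<phi>2 x = p x" "branch T (-1/2) (-1/2) u1 u2 \<phi>1 \<phi>2 x = m x"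
      unfolding branch_def sys[OF x] by (simp_all add: sys[OF x] field_simps)
  qed
qed

section \<open>The control operator\<close>

lemma C2_on_imp_continuous_on: "C2_on S f \<Longrightarrow> continuous_on S f"
  by (erule C2_on_partials) (rule has_derivative_continuous_on)

lemma set_integral_Ioo_eq_Icc: "(LBINT x:{a<..<b}. f x) = (LBINT x:{a..b}. f x)"
  for a b :: real and f :: "real \<Rightarrow> real"
  by (rule set_integral_discrete_difference[where X="{a, b}"]) auto

context
  fixes w1 w2 :: "real \<Rightarrow> real \<Rightarrow> real" and T :: real
  assumes right: "continuous_on (triangle T) (case_prod w1)" "continuous_on (triangle T) (case_prod w2)"
    and left: "continuous_on (triangle T) (case_prod (\<lambda>x. w1 (- x)))"
      "continuous_on (triangle T) (case_prod (\<lambda>x. w2 (- x)))"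
begin

definition right_branch where
  "right_branch f1 f2 = branch T (1/2) (-1/2) w1 w2 (\<lambda>s. f1 (T - s)) (\<lambda>s. f2 (T - s))"

definition left_branch where
  "left_branch f1 f2 = branch T (-1/2) (-1/2) (\<lambda>x. w1 (- x)) (\<lambda>x. w2 (- x)) (\<lambda>s. f1 (T - s)) (\<lambda>s. f2 (T - s))"

lemma in_FT_reflect:
  assumes "in_FT T f1 f2"
  shows "L2_on {0..T} (\<lambda>s. f1 (T - s))" "L2_on {0..T} (\<lambda>s. f2 (T - s))"
  using assms by (simp_all add: in_FT_def L2_on_Icc_iff_Ioo L2_on_reflect)

text \<open>The inequalities are strict because \<open>uF\<close> takes its default value 0 at
  \<open>x = 0\<close> and at \<open>\<bar>x\<bar> = T\<close>.\<close>

lemma WT_eq_branch: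
  assumes f: "in_FT T f1 f2" and x: "0 < x" "x < T"
  shows "WT w1 w2 T f1 f2 x = right_branch f1 f2 x"
    and "WT w1 w2 T f1 f2 (- x) = left_branch f1 f2 x"
proof -
  note L2 = in_FT_reflect[OF f]
  have m: "(\<lambda>s. f1 (T - s)) \<in> borel_measurable borel" "(\<lambda>s. f2 (T - s)) \<in> borel_measurable borel"
    using L2 by (simp_all add: L2_on_def)
  have eq: "(LBINT s=x..T. v1 x s * f1 (T - s) + v2 x s * f2 (T - s))
      = volterra T v1 (\<lambda>s. f1 (T - s)) x + volterra T v2 (\<lambda>s. f2 (T - s)) x"
    if "continuous_on (triangle T) (case_prod v1)" "continuous_on (triangle T) (case_prod v2)" for v1 v2
  proof -
    note e = volterra_eq[OF that(1) L2_on_imp_integrable[OF L2(1)] m(1), of x]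
      volterra_eq[OF that(2) L2_on_imp_integrable[OF L2(2)] m(2), of x]
    show ?thesis
      using x e by (simp add: interval_integral_Icc set_integral_add)
  qed
  show "WT w1 w2 T f1 f2 x = right_branch f1 f2 x"
    using x eq[OF right] by (simp add: WT_def uF_def right_branch_def branch_def)
  show "WT w1 w2 T f1 f2 (- x) = left_branch f1 f2 x"
    using x eq[OF left] by (simp add: WT_def uF_def left_branch_def branch_def)
qed

lemma L2_on_branches:
  assumes "in_FT T f1 f2"
  shows "L2_on {0..T} (right_branch f1 f2)" "L2_on {0..T} (left_branch f1 f2)"
  unfolding right_branch_def left_branch_def
  by (intro L2_on_branch right left in_FT_reflect[OF assms])+

lemma in_FT_diff:
  "in_FT T f1 f2 \<Longrightarrow> in_FT T g1 g2 \<Longrightarrow> in_FT T (\<lambda>t. f1 t - g1 t) (\<lambda>t. f2 t - g2 t)"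
  by (auto simp: in_FT_def intro!: L2_on_diff)

lemma branches_diff:
  assumes "in_FT T f1 f2" "in_FT T g1 g2"
  shows "right_branch (\<lambda>t. f1 t - g1 t) (\<lambda>t. f2 t - g2 t) x = right_branch f1 f2 x - right_branch g1 g2 x"
    and "left_branch (\<lambda>t. f1 t - g1 t) (\<lambda>t. f2 t - g2 t) x = left_branch f1 f2 x - left_branch g1 g2 x"
  unfolding right_branch_def left_branch_def
  by (rule branch_diff[OF right] branch_diff[OF left]; rule in_FT_reflect[OF assms(1)] in_FT_reflect[OF assms(2)])+

text \<open>Splitting at 0 turns the inner product on (-T, T) into two on (0, T). Agreement with the
  branches on the open interval suffices, as endpoints do not affect the integrals.\<close>

lemma WT_inner_eq:
  assumes T: "0 \<le> T" and f: "in_FT T f1 f2" and g: "in_FT T g1 g2"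
  shows "(LBINT x=-T..T. WT w1 w2 T f1 f2 x * WT w1 w2 T g1 g2 x) =
      (LBINT x:{0..T}. right_branch f1 f2 x * right_branch g1 g2 x)
    + (LBINT x:{0..T}. left_branch f1 f2 x * left_branch g1 g2 x)"
proof -
  let ?h = "\<lambda>x. WT w1 w2 T f1 f2 x * WT w1 w2 T g1 g2 x"
  have "set_integrable lborel {0<..<T} ?h = set_integrable lborel {0<..<T} (\<lambda>x. right_branch f1 f2 x * right_branch g1 g2 x)"
    "set_integrable lborel {0<..<T} (\<lambda>x. ?h (- x)) = set_integrable lborel {0<..<T} (\<lambda>x. left_branch f1 f2 x * left_branch g1 g2 x)"
    by (intro set_integrable_cong refl; simp add: WT_eq_branch[OF f] WT_eq_branch[OF g])+
  then have int: "set_integrable lborel {0..T} ?h" "set_integrable lborel {0..T} (\<lambda>x. ?h (- x))"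
    unfolding set_integrable_Icc_iff_Ioo
    using L2_on_times[OF L2_on_branches(1)[OF f] L2_on_branches(1)[OF g]]
      L2_on_times[OF L2_on_branches(2)[OF f] L2_on_branches(2)[OF g]] by simp_all
  have "(LBINT x:{0<..<T}. ?h x) = (LBINT x:{0<..<T}. right_branch f1 f2 x * right_branch g1 g2 x)"
    "(LBINT x:{0<..<T}. ?h (- x)) = (LBINT x:{0<..<T}. left_branch f1 f2 x * left_branch g1 g2 x)"
    by (intro set_lebesgue_integral_cong; simp add: WT_eq_branch[OF f] WT_eq_branch[OF g])+
  with symmetric_interval_integral[OF T int] show ?thesis
    unfolding set_integral_Ioo_eq_Icc by simp
qed

lemma control_eq_zero_AE:
  assumes f: "in_FT T f1 f2"
    and "AE x in lborel. x \<in> {0..T} \<longrightarrow> right_branch f1 f2 x = 0"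
      "AE x in lborel. x \<in> {0..T} \<longrightarrow> left_branch f1 f2 x = 0"
  shows "AE t in lborel. t \<in> {0<..<T} \<longrightarrow> f1 t = 0 \<and> f2 t = 0"
proof -
  have "AE x in lborel. x \<in> {0..T} \<longrightarrow> f1 (T - x) = 0 \<and> f2 (T - x) = 0"
    using branches_injective[OF right left in_FT_reflect[OF f]] assms(2,3)
    by (simp add: right_branch_def left_branch_def)
  moreover have [measurable]: "f1 \<in> borel_measurable borel" "f2 \<in> borel_measurable borel"
    using f by (simp_all add: in_FT_def L2_on_def)
  \<comment> \<open>Measurability of the predicate lets the almost everywhere statement be
    transported back along \<open>t \<mapsto> T - t\<close>.\<close>
  have "Measurable.pred borel (\<lambda>x. x \<in> {0..T} \<longrightarrow> f1 (T - x) = 0 \<and> f2 (T - x) = 0)"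
    by measurable
  ultimately have "AE t in lborel. T + -1 * t \<in> {0..T} \<longrightarrow> f1 (T - (T + -1 * t)) = 0 \<and> f2 (T - (T + -1 * t)) = 0"
    using AE_borel_affine[of "-1" "\<lambda>x. x \<in> {0..T} \<longrightarrow> f1 (T - x) = 0 \<and> f2 (T - x) = 0" T] by simp
  then show ?thesis
    by eventually_elim auto
qed

text \<open>Piecewise description by the Borel branches. It is used to reflect an almost everywhere
  identity for \<open>WT\<close> to the left half-line.\<close>

lemma WT_measurable:
  assumes f: "in_FT T f1 f2"
  shows "WT w1 w2 T f1 f2 \<in> borel_measurable borel"
proof -
  have [measurable]: "right_branch f1 f2 \<in> borel_measurable borel" "left_branch f1 f2 \<in> borel_measurable borel"
    using L2_on_branches[OF f] by (simp_all add: L2_on_def)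
  have "WT w1 w2 T f1 f2 x =
      (if 0 < x \<and> x < T then right_branch f1 f2 x
       else if 0 < - x \<and> - x < T then left_branch f1 f2 (- x) else 0)" for x
    using WT_eq_branch(1)[OF f, of x] WT_eq_branch(2)[OF f, of "- x"] by (auto simp: WT_def uF_def)
  then show ?thesis
    by (subst measurable_cong[where g="\<lambda>x. if 0 < x \<and> x < T then right_branch f1 f2 x
       else if 0 < - x \<and> - x < T then left_branch f1 f2 (- x) else 0"]) auto
qed

end

lemma kernels_continuous_on_triangle:
  assumes "C2_on wedge (case_prod w)" "C2_on {(x, t). - t \<le> x \<and> x \<le> 0} (case_prod w)"
  shows "continuous_on (triangle T) (case_prod w)" "continuous_on (triangle T) (case_prod (\<lambda>x. w (- x)))"
proof -
  show "continuous_on (triangle T) (case_prod w)"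
    by (rule continuous_on_subset[OF C2_on_imp_continuous_on[OF assms(1)]]) (auto simp: triangle_def)
  have "continuous_on (triangle T) (\<lambda>z. case_prod w (- fst z, snd z))"
    by (intro continuous_on_compose2[OF C2_on_imp_continuous_on[OF assms(2)]] continuous_intros)
      (auto simp: triangle_def)
  then show "continuous_on (triangle T) (case_prod (\<lambda>x. w (- x)))"
    by (simp add: case_prod_beta')
qed

theorem mainTheorem6:
  fixes q y y' :: "real \<Rightarrow> real" and w1 w2 :: "real \<Rightarrow> real \<Rightarrow> real" and T :: real
  assumes q_C2: "C2_fun q" and q_L1: "integrable lborel q"
    and kern: "kernels q w1 w2"
    and y_deriv: "\<And>x. (y has_real_derivative y' x) (at x)"
    and y'_deriv: "\<And>x. (y' has_real_derivative q x * y x) (at x)"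
    and y0: "y 0 = 0" and y'0: "y' 0 = 1"
    and T_pos: "0 < T"
  shows "\<exists>f1 f2. in_FT T f1 f2
      \<and> (AE x in lborel. x \<in> {-T<..<T} \<longrightarrow> WT w1 w2 T f1 f2 x = y x)
      \<and> (\<forall>g1 g2. in_FT T g1 g2 \<and> (AE x in lborel. x \<in> {-T<..<T} \<longrightarrow> WT w1 w2 T g1 g2 x = y x)
            \<longrightarrow> (AE t in lborel. t \<in> {0<..<T} \<longrightarrow> g1 t = f1 t \<and> g2 t = f2 t))
      \<and> CT_eq w1 w2 T f1 f2 (\<lambda>t. T - t) (\<lambda>t. 0)
      \<and> (\<forall>g1 g2. in_FT T g1 g2 \<and> CT_eq w1 w2 T g1 g2 (\<lambda>t. T - t) (\<lambda>t. 0)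
            \<longrightarrow> (AE t in lborel. t \<in> {0<..<T} \<longrightarrow> g1 t = f1 t \<and> g2 t = f2 t))"
proof -
  have C2: "C2_on wedge (case_prod w)" "C2_on {(x, t). - t \<le> x \<and> x \<le> 0} (case_prod w)"
    and pde: "\<And>x t. 0 < \<bar>x\<bar> \<Longrightarrow> \<bar>x\<bar> < t \<Longrightarrow>
      deriv (\<lambda>s. deriv (\<lambda>s'. w x s') s) t - deriv (\<lambda>y. deriv (\<lambda>y'. w y' t) y) x + q x * w x t = 0"
    and diagl: "\<And>x. x < 0 \<Longrightarrow> ((\<lambda>x. w x (- x)) has_real_derivative - q x / 4) (at x)"
    if "w = w1 \<or> w = w2" for w
    using kern that unfolding kernels_def by auto
  have diagr: "((\<lambda>x. w1 x x) has_real_derivative - q x / 4) (at x)"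
      "((\<lambda>x. w2 x x) has_real_derivative q x / 4) (at x)" if "0 < x" for x
    using kern that unfolding kernels_def by auto
  note right = kernels_continuous_on_triangle(1)[OF C2[of w1], of T, simplified]
    kernels_continuous_on_triangle(1)[OF C2[of w2], of T, simplified]
  note left = kernels_continuous_on_triangle(2)[OF C2[of w1], of T, simplified]
    kernels_continuous_on_triangle(2)[OF C2[of w2], of T, simplified]
  note cont = right left
  let ?R = "right_branch w1 w2 T" and ?L = "left_branch w1 w2 T"
  have cy: "continuous_on A y" "continuous_on A (\<lambda>x. y (- x))" for A
  proof -
    have *: "continuous_on A y" for A
      by (intro continuous_at_imp_continuous_on ballI DERIV_isCont[OF y_deriv])
    show "continuous_on A y" "continuous_on A (\<lambda>x. y (- x))"
      by (intro * continuous_on_compose2[OF *[of UNIV]] continuous_intros; simp)+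
  qed
  \<comment> \<open>The amplitudes of \<open>f1\<close> on the right and left fronts are 1/2 and
    -1/2, so \<open>(a - b) * y' 0 = 1\<close>; those of \<open>f2\<close> are both -1/2, so the
    second moment is 0.\<close>
  have moment1: "1/2 * y s + integral {0..s} (\<lambda>x. w1 x s * y x)
      + (-1/2 * y (- s) + integral {0..s} (\<lambda>x. w1 (- x) s * y (- x))) = s" if "0 \<le> s" for s
    using goursat_moment[of w1 q "1/2" "-1/2" y y' s, OF C2 pde _ _ y_deriv y'_deriv y0 that]
      diagr(1) diagl[of w1] y'0 by simp
  have moment2: "-1/2 * y s + integral {0..s} (\<lambda>x. w2 x s * y x)
      + (-1/2 * y (- s) + integral {0..s} (\<lambda>x. w2 (- x) s * y (- x))) = 0" if "0 \<le> s" for s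
    using goursat_moment[of w2 q "-1/2" "-1/2" y y' s, OF C2 pde _ _ y_deriv y'_deriv y0 that]
      diagr(2) diagl[of w2] by simp

  \<comment> \<open>A control that steers to \<open>y\<close>\<close>
  obtain \<phi>1 \<phi>2 where \<phi>: "L2_on {0..T} \<phi>1" "L2_on {0..T} \<phi>2"
    "\<And>x. x \<in> {0..T} \<Longrightarrow> branch T (1/2) (-1/2) w1 w2 \<phi>1 \<phi>2 x = y x"
    "\<And>x. x \<in> {0..T} \<Longrightarrow> branch T (-1/2) (-1/2) (\<lambda>x. w1 (- x)) (\<lambda>x. w2 (- x)) \<phi>1 \<phi>2 x = y (- x)"
    using branches_solvable[OF less_imp_le[OF T_pos] right left cy] by blast
  define f1 where "f1 t = \<phi>1 (T - t)" for t
  define f2 where "f2 t = \<phi>2 (T - t)" for t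
  have f: "in_FT T f1 f2"
    using \<phi> by (simp add: in_FT_def L2_on_Icc_iff_Ioo f1_def[abs_def] f2_def[abs_def] L2_on_reflect)
  have Rf: "?R f1 f2 x = y x" and Lf: "?L f1 f2 x = y (- x)" if "x \<in> {0..T}" for x
    using \<phi>(3,4)[OF that] by (simp_all add: right_branch_def[OF cont] left_branch_def[OF cont] f1_def f2_def)
  have WTf: "WT w1 w2 T f1 f2 x = y x" if "x \<in> {-T<..<T}" for x
  proof (cases x "0 :: real" rule: linorder_cases)
    case less
    then show ?thesis
      using WT_eq_branch(2)[OF cont f, of "- x"] Lf[of "- x"] that by simp
  next
    case equal
    then show ?thesis
      \<comment> \<open>The default value 0 of \<open>uF\<close> at the origin coincides with
        \<open>y 0\<close>.\<close>
      by (simp add: WT_def uF_def y0)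
  next
    case greater
    then show ?thesis
      using WT_eq_branch(1)[OF cont f, of x] Rf[of x] that by simp
  qed

  \<comment> \<open>Uniqueness of the control reaching \<open>y\<close>\<close>
  have zero_diff: "AE t in lborel. t \<in> {0<..<T} \<longrightarrow> g1 t = f1 t \<and> g2 t = f2 t"
    if g: "in_FT T g1 g2"
      and "AE x in lborel. x \<in> {0..T} \<longrightarrow> ?R g1 g2 x = ?R f1 f2 x"
        "AE x in lborel. x \<in> {0..T} \<longrightarrow> ?L g1 g2 x = ?L f1 f2 x" for g1 g2
    \<comment> \<open>By linearity the branches of the difference vanish, and injectivity applies.
      Both uniqueness claims are reduced to this.\<close>
    using control_eq_zero_AE[OF cont in_FT_diff[OF cont g f]] that(2,3)
    by (simp add: branches_diff[OF cont g f])
  have unique1: "AE t in lborel. t \<in> {0<..<T} \<longrightarrow> g1 t = f1 t \<and> g2 t = f2 t"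
    if g: "in_FT T g1 g2"
      and eq: "AE x in lborel. x \<in> {-T<..<T} \<longrightarrow> WT w1 w2 T g1 g2 x = y x" for g1 g2
  proof (rule zero_diff[OF g])
    have [measurable]: "WT w1 w2 T g1 g2 \<in> borel_measurable borel" "y \<in> borel_measurable borel"
      using WT_measurable[OF cont g] cy(1)[of UNIV] by (simp_all add: borel_measurable_continuous_onI)
    have "Measurable.pred borel (\<lambda>x. x \<in> {-T<..<T} \<longrightarrow> WT w1 w2 T g1 g2 x = y x)"
      by measurable
    \<comment> \<open>Null sets are invariant under \<open>x \<mapsto> - x\<close>, which supplies
      the identity for the left branch; the points 0 and \<open>T\<close> are then discarded as
      null.\<close>
    from AE_borel_affine[of "-1", OF _ this eq, of 0]
    have eq': "AE x in lborel. - x \<in> {-T<..<T} \<longrightarrow> WT w1 w2 T g1 g2 (- x) = y (- x)"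
      by simp
    have ne: "AE x in lborel. x \<noteq> 0" "AE x in lborel. x \<noteq> T"
      by (rule AE_lborel_singleton)+
    show "AE x in lborel. x \<in> {0..T} \<longrightarrow> ?R g1 g2 x = ?R f1 f2 x"
      using eq ne by eventually_elim (use WT_eq_branch(1)[OF cont g] Rf T_pos in auto)
    show "AE x in lborel. x \<in> {0..T} \<longrightarrow> ?L g1 g2 x = ?L f1 f2 x"
      using eq' ne by eventually_elim (use WT_eq_branch(2)[OF cont g] Lf T_pos in auto)
  qed

  \<comment> \<open>The equation satisfied by the control\<close>
  have target: "in_FT T (\<lambda>t. T - t) (\<lambda>t. 0)"
    unfolding in_FT_def L2_on_Icc_iff_Ioo
    by (intro conjI L2_on_continuous continuous_intros) auto
  have CTf: "CT_eq w1 w2 T f1 f2 (\<lambda>t. T - t) (\<lambda>t. 0)"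
    unfolding CT_eq_def
  proof (intro conjI target allI impI)
    fix g1 g2 assume g: "in_FT T g1 g2"
    let ?\<gamma>1 = "\<lambda>s. g1 (T - s)" and ?\<gamma>2 = "\<lambda>s. g2 (T - s)"
    note \<gamma> = in_FT_reflect[OF cont g]
    note mR = branch_moment[OF right \<gamma> cy(1)]
    note mL = branch_moment[OF left \<gamma> cy(2)]
    \<comment> \<open>Merges the right and left weights of one control component, so that
      \<open>moment1\<close> and \<open>moment2\<close> can replace their sum.\<close>
    have collapse: "(LBINT s:{0..T}. a s * \<gamma> s + b s * \<gamma> s) = (LBINT s:{0..T}. c s * \<gamma> s)"
      if "\<And>s. 0 \<le> s \<Longrightarrow> a s + b s = c s" for a b c \<gamma> :: "real \<Rightarrow> real"
      by (rule set_lebesgue_integral_cong) (auto simp: that[symmetric] distrib_right)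
    have "(LBINT x=-T..T. WT w1 w2 T f1 f2 x * WT w1 w2 T g1 g2 x)
        = (LBINT x:{0..T}. ?R f1 f2 x * ?R g1 g2 x) + (LBINT x:{0..T}. ?L f1 f2 x * ?L g1 g2 x)"
      by (rule WT_inner_eq[OF cont less_imp_le[OF T_pos] f g])
    also have "(LBINT x:{0..T}. ?R f1 f2 x * ?R g1 g2 x) = (LBINT x:{0..T}. y x * ?R g1 g2 x)"
      by (rule set_lebesgue_integral_cong) (simp_all add: Rf)
    also have "(LBINT x:{0..T}. ?L f1 f2 x * ?L g1 g2 x) = (LBINT x:{0..T}. y (- x) * ?L g1 g2 x)"
      by (rule set_lebesgue_integral_cong) (simp_all add: Lf)
    also have "(LBINT x:{0..T}. y x * ?R g1 g2 x) + (LBINT x:{0..T}. y (- x) * ?L g1 g2 x)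
      = (LBINT s:{0..T}. (1/2 * y s + integral {0..s} (\<lambda>x. w1 x s * y x)) * ?\<gamma>1 s
          + (-1/2 * y (- s) + integral {0..s} (\<lambda>x. w1 (- x) s * y (- x))) * ?\<gamma>1 s)
      + (LBINT s:{0..T}. (-1/2 * y s + integral {0..s} (\<lambda>x. w2 x s * y x)) * ?\<gamma>2 s
          + (-1/2 * y (- s) + integral {0..s} (\<lambda>x. w2 (- x) s * y (- x))) * ?\<gamma>2 s)"
      unfolding right_branch_def[OF cont] left_branch_def[OF cont] mR(1) mL(1)
        set_integral_add(2)[OF mR(2)[of "1/2"] mL(2)[of "-1/2"]]
        set_integral_add(2)[OF mR(3)[of "-1/2"] mL(3)[of "-1/2"]] by simp
    also have "\<dots> = (LBINT s:{0..T}. s * ?\<gamma>1 s) + (LBINT s:{0..T}. 0 * ?\<gamma>2 s)"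
      by (rule arg_cong2[where f="(+)"]; rule collapse; erule moment1 moment2)
    \<comment> \<open>Writing \<open>s\<close> as \<open>T - (T - s)\<close> makes the integrand a
      function of \<open>T - s\<close>; undoing the time reversal turns the weight \<open>s\<close>
      into \<open>T - t\<close>.\<close>
    also have "\<dots> = (LBINT s:{0..T}. (T - (T - s)) * g1 (T - s))"
      by (simp add: set_lebesgue_integral_def)
    also have "\<dots> = (LBINT t:{0..T}. (T - t) * g1 t)"
      by (rule set_integral_reflect_Icc)
    also have "\<dots> = (LBINT t=0..T. (T - t) * g1 t + 0 * g2 t)"
      using T_pos interval_integral_Icc[of 0 T "\<lambda>t. (T - t) * g1 t"] by (simp add: zero_ereal_def)
    finally show "(LBINT t=0..T. (T - t) * g1 t + 0 * g2 t)
        = (LBINT x=-T..T. WT w1 w2 T f1 f2 x * WT w1 w2 T g1 g2 x)"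
      by simp
  qed

  \<comment> \<open>Uniqueness for the equation with the connecting operator\<close>
  have unique2: "AE t in lborel. t \<in> {0<..<T} \<longrightarrow> g1 t = f1 t \<and> g2 t = f2 t"
    if g: "in_FT T g1 g2" and CTg: "CT_eq w1 w2 T g1 g2 (\<lambda>t. T - t) (\<lambda>t. 0)" for g1 g2
  proof (rule zero_diff[OF g])
    let ?h1 = "\<lambda>t. g1 t - f1 t" and ?h2 = "\<lambda>t. g2 t - f2 t"
    note h = in_FT_diff[OF cont g f]
    note T0 = less_imp_le[OF T_pos]
    note L2h = L2_on_branches[OF cont h]
    have int: "set_integrable lborel {0..T} (\<lambda>x. b x * c x)" if "L2_on {0..T} b" "L2_on {0..T} c" for b c
      using L2_on_times[OF that] by simp
    \<comment> \<open>Both equations are tested with the difference \<open>(?h1, ?h2)\<close>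
      itself. Subtracting them shows that the squared norm of its image under \<open>WT\<close> is
      0.\<close>
    have "(LBINT x=-T..T. WT w1 w2 T g1 g2 x * WT w1 w2 T ?h1 ?h2 x)
        = (LBINT x=-T..T. WT w1 w2 T f1 f2 x * WT w1 w2 T ?h1 ?h2 x)"
      using CTg[unfolded CT_eq_def, THEN conjunct2, rule_format, OF h]
        CTf[unfolded CT_eq_def, THEN conjunct2, rule_format, OF h] by (rule trans[OF sym])
    then have "(LBINT x:{0..T}. ?R g1 g2 x * ?R ?h1 ?h2 x) + (LBINT x:{0..T}. ?L g1 g2 x * ?L ?h1 ?h2 x)
        = (LBINT x:{0..T}. ?R f1 f2 x * ?R ?h1 ?h2 x) + (LBINT x:{0..T}. ?L f1 f2 x * ?L ?h1 ?h2 x)"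
      unfolding WT_inner_eq[OF cont T0 g h] WT_inner_eq[OF cont T0 f h] .
    moreover have "(LBINT x:{0..T}. ?R ?h1 ?h2 x * ?R ?h1 ?h2 x)
        = (LBINT x:{0..T}. ?R g1 g2 x * ?R ?h1 ?h2 x) - (LBINT x:{0..T}. ?R f1 f2 x * ?R ?h1 ?h2 x)"
      by (subst set_integral_diff(2)[OF int[OF L2_on_branches(1)[OF cont g] L2h(1)]
          int[OF L2_on_branches(1)[OF cont f] L2h(1)], symmetric])
        (simp only: branches_diff(1)[OF cont g f] left_diff_distrib)
    moreover have "(LBINT x:{0..T}. ?L ?h1 ?h2 x * ?L ?h1 ?h2 x)
        = (LBINT x:{0..T}. ?L g1 g2 x * ?L ?h1 ?h2 x) - (LBINT x:{0..T}. ?L f1 f2 x * ?L ?h1 ?h2 x)"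
      by (subst set_integral_diff(2)[OF int[OF L2_on_branches(2)[OF cont g] L2h(2)]
          int[OF L2_on_branches(2)[OF cont f] L2h(2)], symmetric])
        (simp only: branches_diff(2)[OF cont g f] left_diff_distrib)
    ultimately have "(LBINT x:{0..T}. ?R ?h1 ?h2 x * ?R ?h1 ?h2 x) + (LBINT x:{0..T}. ?L ?h1 ?h2 x * ?L ?h1 ?h2 x) = 0"
      by simp
    moreover have nonneg: "0 \<le> (LBINT x:{0..T}. b x * b x)" for b :: "real \<Rightarrow> real"
      unfolding set_lebesgue_integral_def by (rule Bochner_Integration.integral_nonneg) auto
    ultimately have zero: "(LBINT x:{0..T}. ?R ?h1 ?h2 x * ?R ?h1 ?h2 x) = 0"
      "(LBINT x:{0..T}. ?L ?h1 ?h2 x * ?L ?h1 ?h2 x) = 0"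
      using nonneg[of "?R ?h1 ?h2"] nonneg[of "?L ?h1 ?h2"] by linarith+
    \<comment> \<open>Each branch contributes a nonnegative square integral and the two add up to 0,
      so each branch vanishes almost everywhere.\<close>
    have null: "AE x in lborel. x \<in> {0..T} \<longrightarrow> b x = 0"
      if "L2_on {0..T} b" "(LBINT x:{0..T}. b x * b x) = 0" for b
    proof -
      have "AE x in lborel. indicator {0..T} x *\<^sub>R (b x * b x) = 0"
        using that(2) int[OF that(1,1)] unfolding set_lebesgue_integral_def set_integrable_def
        by (subst (asm) integral_nonneg_eq_0_iff_AE) auto
      then show ?thesis
        by eventually_elim auto
    qed
    show "AE x in lborel. x \<in> {0..T} \<longrightarrow> ?R g1 g2 x = ?R f1 f2 x"
      using null[OF L2h(1) zero(1)] unfolding branches_diff(1)[OF cont g f] by simp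
    show "AE x in lborel. x \<in> {0..T} \<longrightarrow> ?L g1 g2 x = ?L f1 f2 x"
      using null[OF L2h(2) zero(2)] unfolding branches_diff(2)[OF cont g f] by simp
  qed
  show ?thesis
  proof (rule exI[of _ f1], rule exI[of _ f2], intro conjI allI impI)
    show "AE x in lborel. x \<in> {- T<..<T} \<longrightarrow> WT w1 w2 T f1 f2 x = y x"
      using WTf by (intro AE_I2 impI)
  qed (use f CTf unique1 unique2 in simp_all)
qed

end
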